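(* Let $k\ge2$ and $|q|<1$. Then \[ \sum_{n_1,n_2,\dotsc,n_k\ge0} \frac{q^{n_1n_2 + n_2n_3 + \dotsb + n_{k-1}n_k + n_1+n_2+\dotsb+n_k}(-1)_{n_1}} {(q)_{n_1}^2(q)_{n_2}^2\dotsm (q)_{n_k}^2} = \frac{(-q)_\infty}{(q)_\infty^{k+1}} \left(\sum_{n\ge0}+(-1)^{k}\sum_{n<0}\right) (-1)^{(k+1)n} q^{\frac{(k+2)n^2+kn}{2}}, \] and \[ \sum_{n_1,n_2,\dotsc,n_k\ge0} \frac{q^{n_1n_2 + n_2n_3 + \dotsb + n_{k-1}n_k + n_1+n_2+\dotsb+n_k}(-q^{\frac12})_{n_1}} {(q)_{n_1}^2(q)_{n_2}^2\dotsm (q)_{n_k}^2} = \frac{(-q^{\frac12})_\infty}{(q)_\infty^{k+1}} \left(\sum_{n\ge0}+(-1)^{k}\sum_{n<0}\right) (-1)^{(k+1)n} q^{\frac{(k+2)n^2+(k+1)n}{2}}. \]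
   Context: $(a)_n=(a;q)_n=\prod_{i=0}^{n-1}(1-aq^i)$ and $(a)_\infty=\prod_{i\ge0}(1-aq^i)$; in particular $(-1)_{n}=\prod_{i=0}^{n-1}(1+q^i)$. The sums on the right run over integers $n$. *)

theory Defs
  imports "HOL-Analysis.Analysis"
begin

definition qpoch :: "complex \<Rightarrow> complex \<Rightarrow> nat \<Rightarrow> complex" where
  "qpoch a q n = (\<Prod>i<n. 1 - a * q ^ i)"

definition qpoch_inf :: "complex \<Rightarrow> complex \<Rightarrow> complex" where
  "qpoch_inf a q = (\<Prod>i. 1 - a * q ^ i)"

definition signed_bisum :: "complex \<Rightarrow> (int \<Rightarrow> complex) \<Rightarrow> complex" where
  "signed_bisum c f = (\<Sum>\<^sub>\<infinity>n\<in>{0..}. f n) + c * (\<Sum>\<^sub>\<infinity>n\<in>{..<0}. f n)"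

text \<open>
  Multi-indices \<open>(n\<^sub>1, \<dots>, n\<^sub>k)\<close> are the extensional functions in
  \<open>{1..k} \<rightarrow>\<^sub>E UNIV\<close>, so that each tuple is counted exactly once.
\<close>
definition chain_exponent :: "nat \<Rightarrow> (nat \<Rightarrow> nat) \<Rightarrow> nat" where
  "chain_exponent k n = (\<Sum>i=1..<k. n i * n (Suc i)) + (\<Sum>i=1..k. n i)"

definition chain_term :: "nat \<Rightarrow> complex \<Rightarrow> complex \<Rightarrow> (nat \<Rightarrow> nat) \<Rightarrow> complex" where
  "chain_term k a q n =
     q ^ chain_exponent k n * qpoch a q (n 1) / (\<Prod>i=1..k. (qpoch q q (n i))\<^sup>2)"

end

theory Submission
  imports Defs
begin

text \<open>
  The sum over \<open>n\<^sub>1, \<dots>, n\<^sub>k\<close> is a matrix element of the \<open>(k - 1)\<close>-st power of the kernel operator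
  \<open>(K f)(m) = (\<Sum>n. q\<^bsup>mn + n\<^esup> f(n) / (q)\<^sub>n\<^sup>2)\<close>. This operator is diagonalised by
  \<open>\<phi>\<^sub>v(m) = (q)\<^sub>m P\<^sub>v(q\<^sup>m)\<close>, where \<open>P\<^sub>v\<close> is the little \<open>q\<close>-Legendre polynomial: by the
  \<open>q\<close>-binomial theorem \<open>K\<close> maps \<open>(q)\<^sub>m x\<^sup>i\<close>, with \<open>x = q\<^sup>m\<close>, to \<open>(q)\<^sub>m (xq)\<^sub>i / (q)\<^sub>\<infinity>\<close>, and the
  eigenvalue is \<open>(-1)\<^sup>v q\<^bsup>v(v + 1)/2\<^esup> / (q)\<^sub>\<infinity>\<close>. Expanding the constant function \<open>1\<close> in the \<open>\<phi>\<^sub>v\<close>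
  and evaluating the sum over \<open>n\<^sub>1\<close> against \<open>\<phi>\<^sub>v\<close> by the \<open>q\<close>-Chu--Vandermonde formula gives a single sum
  over \<open>v\<close>, whose factor \<open>1 - q\<^bsup>2v + 1\<^esup>\<close> (or \<open>1 - q\<^bsup>v + 1/2\<^esup>\<close>) pairs the indices \<open>v\<close> and \<open>-v - 1\<close>
  of the theta series.
\<close>

section \<open>Finite \<open>q\<close>-identities\<close>

lemma qpoch_0 [simp]: "qpoch a q 0 = 1"
  by (simp add: qpoch_def)

lemma qpoch_Suc: "qpoch a q (Suc n) = qpoch a q n * (1 - a * q ^ n)"
  by (simp add: qpoch_def)

lemma qpoch_rec: "qpoch a q (Suc n) = (1 - a) * qpoch (a * q) q n"
  unfolding qpoch_def by (subst prod.lessThan_Suc_shift) (simp add: mult_ac)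

lemma qpoch_add: "qpoch a q (m + n) = qpoch a q m * qpoch (a * q ^ m) q n"
  by (induction n) (simp_all add: qpoch_Suc power_add mult_ac)

lemma choose_two_Suc: "Suc n choose 2 = n + (n choose 2)"
  by (simp add: numeral_2_eq_2)

lemma choose_two_add: "(m + n) choose 2 = (m choose 2) + (n choose 2) + m * n"
proof (induction n)
  case (Suc n)
  then show ?case by (simp add: choose_two_Suc)
qed simp

lemma choose_two_double: "2 * (n choose 2) + n = n * n"
  by (induction n) (simp_all add: choose_two_Suc)

lemma choose_two_0 [simp]: "0 choose 2 = 0"
  by (simp add: numeral_2_eq_2)

text \<open>Gaussian binomial coefficient. The \<open>q\<close>-Pascal recursion, in place of a
  quotient, makes sense for every \<open>q\<close>, roots of unity included, and gives zero for
  \<open>k > n\<close>.\<close>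

fun qbin :: "complex \<Rightarrow> nat \<Rightarrow> nat \<Rightarrow> complex" where
  "qbin q n 0 = 1"
| "qbin q 0 (Suc k) = 0"
| "qbin q (Suc n) (Suc k) = q ^ Suc k * qbin q n (Suc k) + qbin q n k"

lemma qbin_eq_0: "n < k \<Longrightarrow> qbin q n k = 0"
  by (induction q n k rule: qbin.induct) auto

text \<open>In the induction the two Pascal terms contribute
  \<open>q^(k+1) (1 - q^(n-k)) + (1 - q^(k+1)) = 1 - q^(n+1)\<close>. The form without division
  holds for all \<open>q\<close>. The case \<open>k = n\<close> stands apart because the first
  Pascal term vanishes there.\<close>

lemma qbin_qpoch: "k \<le> n \<Longrightarrow> qbin q n k * (qpoch q q k * qpoch q q (n - k)) = qpoch q q n"
proof (induction q n k rule: qbin.induct)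
  case (3 q n k)
  have *: "qbin q n k * (qpoch q q k * qpoch q q (n - k)) = qpoch q q n"
    using 3 by simp
  show ?case
  proof (cases "k = n")
    case True
    then show ?thesis using * by (auto simp: qbin_eq_0 qpoch_Suc)
  next
    case False
    then have "Suc k \<le> n" using 3 by simp
    then obtain d where n: "n = Suc k + d" using le_Suc_ex by blast
    have IH: "qbin q n (Suc k) * (qpoch q q (Suc k) * qpoch q q d) = qpoch q q n"
      using 3 n by simp
    have "qbin q (Suc n) (Suc k) * (qpoch q q (Suc k) * qpoch q q (Suc n - Suc k))
        = q ^ Suc k * (1 - q ^ Suc d) * (qbin q n (Suc k) * (qpoch q q (Suc k) * qpoch q q d))
        + (1 - q ^ Suc k) * (qbin q n k * (qpoch q q k * qpoch q q (n - k)))"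
      by (simp add: n qpoch_Suc Suc_diff_le algebra_simps)
    also have "\<dots> = (q ^ Suc k * (1 - q ^ Suc d) + (1 - q ^ Suc k)) * qpoch q q n"
      by (simp only: IH * distrib_right)
    also have "\<dots> = qpoch q q (Suc n)"
      by (simp add: qpoch_Suc n power_add algebra_simps)
    finally show ?thesis .
  qed
qed auto

text \<open>Pascal's recursion under a summation sign: the induction step shared by the finite
  \<open>q\<close>-binomial theorem and the \<open>q\<close>-Chu--Vandermonde sum.\<close>

lemma sum_qbin_Suc:
  "(\<Sum>s\<le>Suc N. f s * qbin q (Suc N) s) =
     (\<Sum>s\<le>N. f s * q ^ s * qbin q N s) + (\<Sum>s\<le>N. f (Suc s) * qbin q N s)"
proof -
  have "(\<Sum>s\<le>Suc N. f s * qbin q (Suc N) s)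
      = f 0 + (\<Sum>s\<le>N. f (Suc s) * q ^ Suc s * qbin q N (Suc s)) + (\<Sum>s\<le>N. f (Suc s) * qbin q N s)"
    by (subst sum.atMost_Suc_shift) (simp add: sum.distrib algebra_simps)
  also have "f 0 + (\<Sum>s\<le>N. f (Suc s) * q ^ Suc s * qbin q N (Suc s))
      = (\<Sum>s\<le>Suc N. f s * q ^ s * qbin q N s)"
    by (subst sum.atMost_Suc_shift) simp
  also have "\<dots> = (\<Sum>s\<le>N. f s * q ^ s * qbin q N s)"
    by (simp add: qbin_eq_0)
  finally show ?thesis .
qed

text \<open>Peeling off the first factor leaves \<open>qpoch (z * q) q n\<close>, so the induction
  needs all \<open>z\<close>. The two sums from \<open>sum_qbin_Suc\<close> carry the factors
  \<open>1\<close> and \<open>- z\<close>.\<close>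

lemma qbinomial_finite:
  "qpoch z q n = (\<Sum>j\<le>n. (-1) ^ j * q ^ (j choose 2) * z ^ j * qbin q n j)"
proof (induction n arbitrary: z)
  case (Suc n)
  show ?case
    unfolding sum_qbin_Suc qpoch_rec Suc[of "z * q"]
    by (simp add: choose_two_Suc power_add power_mult_distrib sum_distrib_left
          algebra_simps sum_negf sum_subtractf)
qed simp

text \<open>The terminating \<open>\<^sub>2\<phi>\<^sub>1\<close> summation, cleared of denominators and of negative powers of \<open>q\<close>.\<close>
lemma q_chu_vandermonde:
  "(\<Sum>s\<le>N. (-1) ^ s * q ^ ((N - s) choose 2) * qpoch b q s * qpoch (c * q ^ s) q (N - s) * qbin q N s)
     = q ^ (N choose 2) * (\<Prod>i<N. b - c * q ^ i)"
proof (induction N arbitrary: b c)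
  case (Suc N)
  \<comment> \<open>The first Pascal sum is the formula for \<open>(b, c)\<close>, the second the
    one for \<open>(b * q, c * q)\<close>. Together they leave the factor
    \<open>q^N (1 - c q^N) - (1 - b) q^N = q^N (b - c q^N)\<close>.\<close>
  have 1: "(\<Sum>s\<le>N. (-1) ^ s * q ^ ((Suc N - s) choose 2) * qpoch b q s
              * qpoch (c * q ^ s) q (Suc N - s) * q ^ s * qbin q N s)
      = q ^ N * (1 - c * q ^ N) * (q ^ (N choose 2) * (\<Prod>i<N. b - c * q ^ i))"
    unfolding Suc[symmetric] sum_distrib_left
  proof (rule sum.cong)
    fix s assume "s \<in> {..N}"
    then obtain d where N: "N = s + d" using le_Suc_ex by auto
    show "(-1) ^ s * q ^ ((Suc N - s) choose 2) * qpoch b q s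
              * qpoch (c * q ^ s) q (Suc N - s) * q ^ s * qbin q N s =
       q ^ N * (1 - c * q ^ N) * ((-1) ^ s * q ^ ((N - s) choose 2) * qpoch b q s
          * qpoch (c * q ^ s) q (N - s) * qbin q N s)"
      by (simp add: N Suc_diff_le choose_two_Suc qpoch_Suc power_add mult_ac)
  qed simp
  have 2: "(\<Sum>s\<le>N. (-1) ^ Suc s * q ^ ((Suc N - Suc s) choose 2) * qpoch b q (Suc s)
              * qpoch (c * q ^ Suc s) q (Suc N - Suc s) * qbin q N s)
      = - (1 - b) * (q ^ (N choose 2) * (\<Prod>i<N. b * q - c * q * q ^ i))"
    unfolding Suc[symmetric] sum_distrib_left
    by (rule sum.cong) (simp_all add: qpoch_rec algebra_simps)
  have 3: "(\<Prod>i<N. b * q - c * q * q ^ i) = q ^ N * (\<Prod>i<N. b - c * q ^ i)"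
  proof -
    have "(\<Prod>i<N. b * q - c * q * q ^ i) = (\<Prod>i<N. q * (b - c * q ^ i))"
      by (rule prod.cong) (simp_all add: algebra_simps)
    then show ?thesis by (simp add: prod.distrib)
  qed
  show ?case
    unfolding sum_qbin_Suc 1 2 3
    by (simp add: choose_two_Suc power_add algebra_simps)
qed simp

text \<open>Both sides equal \<open>(q)_n / ((q)_j (q)_(i-j) (q)_(n-i))\<close>.\<close>

lemma qbin_mult_qbin:
  assumes "\<And>n. qpoch q q n \<noteq> 0" "j \<le> i" "i \<le> n"
  shows "qbin q n i * qbin q i j = qbin q n j * qbin q (n - j) (i - j)"
proof -
  define A where "A = qpoch q q"
  obtain s where i: "i = j + s" using assms le_Suc_ex by blast
  obtain d where n: "n = j + s + d" using assms le_Suc_ex i by blast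
  have nz: "A m \<noteq> 0" for m using assms by (simp add: A_def)
  have 1: "qbin q n i * (A i * A d) = A n" "qbin q i j * (A j * A s) = A i"
    "qbin q n j * (A j * A (s + d)) = A n" "qbin q (s + d) s * (A s * A d) = A (s + d)"
    using qbin_qpoch[of i n q] qbin_qpoch[of j i q] qbin_qpoch[of j n q] qbin_qpoch[of s "s + d" q]
    by (simp_all add: A_def i n add.assoc)
  have "qbin q n i = A n / (A i * A d)" "qbin q i j = A i / (A j * A s)"
    "qbin q n j = A n / (A j * A (s + d))" "qbin q (s + d) s = A (s + d) / (A s * A d)"
    using 1 nz by (simp_all add: eq_divide_eq)
  moreover have "n - j = s + d" "i - j = s" by (simp_all add: n i)
  ultimately show ?thesis using nz by simp
qed

lemma qbin_shift_qpoch: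
  "qbin q (n + i) i * qpoch q q i = qpoch (q ^ Suc n) q i" if "\<And>n. qpoch q q n \<noteq> 0"
proof -
  have "qbin q (n + i) i * qpoch q q i * qpoch q q n = qpoch q q n * qpoch (q ^ Suc n) q i"
    using qbin_qpoch[of i "n + i" q] qpoch_add[of q q n i] by (simp add: mult_ac)
  then show ?thesis using that[of n] by (simp add: mult.commute)
qed

text \<open>For nonzero \<open>q\<close> this is \<open>q^(n choose 2)\<close> times the coefficient
  of \<open>x^i\<close> in \<open>2phi1(q^(-n), q^(n+1); q; q, q x)\<close>. Truncation of
  \<open>n - i\<close> is harmless, as \<open>qbin q n i\<close> vanishes for
  \<open>i > n\<close>.\<close>

definition legendre_coeff :: "complex \<Rightarrow> nat \<Rightarrow> nat \<Rightarrow> complex" where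
  "legendre_coeff q n i = (-1) ^ i * q ^ ((n - i) choose 2) * qbin q n i * qbin q (n + i) i"

text \<open>The little \<open>q\<close>-Legendre polynomial, scaled by \<open>q\<^bsup>n(n-1)/2\<^esup>\<close> so that no negative
  powers of \<open>q\<close> occur.\<close>
definition legendre_poly :: "complex \<Rightarrow> nat \<Rightarrow> complex \<Rightarrow> complex" where
  "legendre_poly q n x = (\<Sum>i\<le>n. legendre_coeff q n i * x ^ i)"

text \<open>The quotients \<open>(q)_i / (a q)_i\<close> are, up to a constant, the moments of
  \<open>x^i\<close> for the weight of the first variable. Clearing denominators by
  \<open>(a q)_n\<close> gives the \<open>q\<close>-Chu--Vandermonde sum with
  \<open>b = q^(n+1)\<close> and \<open>c = a q\<close>.\<close>

lemma legendre_coeff_chu: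
  assumes nz: "\<And>n. qpoch q q n \<noteq> 0" and nza: "\<And>n. qpoch (a * q) q n \<noteq> 0"
  shows "(\<Sum>i\<le>n. legendre_coeff q n i * (qpoch q q i / qpoch (a * q) q i))
     = q ^ (n choose 2) * (\<Prod>i<n. q ^ Suc n - a * q * q ^ i) / qpoch (a * q) q n"
proof -
  have "(\<Sum>i\<le>n. legendre_coeff q n i * (qpoch q q i / qpoch (a * q) q i))
    = (\<Sum>s\<le>n. (-1) ^ s * q ^ ((n - s) choose 2) * qpoch (q ^ Suc n) q s
        * qpoch (a * q * q ^ s) q (n - s) * qbin q n s / qpoch (a * q) q n)"
  proof (rule sum.cong)
    fix s assume "s \<in> {..n}"
    then have "qpoch (a * q) q n = qpoch (a * q) q s * qpoch (a * q * q ^ s) q (n - s)"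
      using qpoch_add[of "a * q" q s "n - s"] by simp
    then show "legendre_coeff q n s * (qpoch q q s / qpoch (a * q) q s) =
      (-1) ^ s * q ^ ((n - s) choose 2) * qpoch (q ^ Suc n) q s
        * qpoch (a * q * q ^ s) q (n - s) * qbin q n s / qpoch (a * q) q n"
      using nza[of s] nza[of n] qbin_shift_qpoch[OF nz, of n s]
      by (simp add: legendre_coeff_def field_simps)
  qed simp
  then show ?thesis
    by (simp only: sum_divide_distrib[symmetric] q_chu_vandermonde)
qed

text \<open>This compares the coefficients of \<open>x^j\<close> in the eigenvector equation
  \<open>legendre_poly_eigen\<close>. After the shift \<open>i = j + s\<close> it is the
  \<open>q\<close>-Chu--Vandermonde sum with \<open>N = n - j\<close>, \<open>b = q^(n+j+1)\<close>
  and \<open>c = q^(j+1)\<close>.\<close>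

lemma legendre_coeff_sum_qbin:
  assumes nz: "\<And>n. qpoch q q n \<noteq> 0" and "j \<le> n"
  shows "(\<Sum>i=j..n. legendre_coeff q n i * qbin q i j) * q ^ (Suc j choose 2) * (-1) ^ j
    = (-1) ^ n * q ^ (Suc n choose 2) * legendre_coeff q n j"
proof -
  obtain N where n: "n = j + N" using assms le_Suc_ex by blast
  define W where "W = qpoch (q ^ Suc j) q"
  have nzW: "W s \<noteq> 0" for s
    using qpoch_add[of q q j s] nz[of "j + s"] by (auto simp: W_def)
  have summand: "legendre_coeff q n (j + s) * qbin q (j + s) j =
      (-1) ^ j * qbin q n j * qbin q (n + j) j / W N *
      ((-1) ^ s * q ^ ((N - s) choose 2) * qpoch (q ^ Suc (n + j)) q s
        * qpoch (q ^ Suc j * q ^ s) q (N - s) * qbin q N s)" if "s \<le> N" for s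
  proof -
    have 1: "qbin q n (j + s) * qbin q (j + s) j = qbin q n j * qbin q N s"
      using qbin_mult_qbin[OF nz, where j = j and i = "j + s" and n = n] that by (simp add: n)
    have 2: "W N = W s * qpoch (q ^ Suc j * q ^ s) q (N - s)"
      using qpoch_add[of "q ^ Suc j" q s "N - s"] that by (simp add: W_def)
    have 3: "qbin q (n + (j + s)) (j + s) * (qpoch q q j * W s)
        = qpoch (q ^ Suc n) q j * qpoch (q ^ Suc (n + j)) q s"
      using qbin_shift_qpoch[OF nz, of n "j + s"]
      by (simp add: qpoch_add W_def power_add mult_ac)
    have 4: "qpoch (q ^ Suc n) q j = qbin q (n + j) j * qpoch q q j"
      using qbin_shift_qpoch[OF nz, of n j] by simp
    have 5: "qbin q (n + (j + s)) (j + s) * W s = qbin q (n + j) j * qpoch (q ^ Suc (n + j)) q s"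
      using 3 4 nz[of j] by (simp add: mult_ac)
    have 6: "qbin q (n + (j + s)) (j + s) =
      qbin q (n + j) j * qpoch (q ^ Suc (n + j)) q s * qpoch (q ^ Suc j * q ^ s) q (N - s) / W N"
      using 5 2 nzW[of N] nzW[of s] by (auto simp: field_simps)
    have "legendre_coeff q n (j + s) * qbin q (j + s) j = (-1) ^ j * (-1) ^ s * q ^ ((N - s) choose 2)
       * (qbin q n (j + s) * qbin q (j + s) j) * qbin q (n + (j + s)) (j + s)"
      by (simp add: legendre_coeff_def n power_add mult_ac)
    then show ?thesis unfolding 1 6 by (simp add: mult_ac)
  qed
  have "(\<Sum>i=j..n. legendre_coeff q n i * qbin q i j)
      = (\<Sum>s\<le>N. legendre_coeff q n (j + s) * qbin q (j + s) j)"
    by (rule sum.reindex_bij_witness[of _ "\<lambda>s. j + s" "\<lambda>i. i - j"]) (auto simp: n)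
  also have "\<dots> = (-1) ^ j * qbin q n j * qbin q (n + j) j / W N *
      (q ^ (N choose 2) * (\<Prod>i<N. q ^ Suc (n + j) - q ^ Suc j * q ^ i))"
    unfolding q_chu_vandermonde[symmetric] sum_distrib_left
    by (rule sum.cong) (use summand in auto)
  \<comment> \<open>Since \<open>n = j + N\<close>, each factor is
    \<open>- q^(j+1+i) (1 - q^(j+1) q^(N-1-i))\<close>; reversing the order of the factors produces
    \<open>W N\<close>.\<close>
  also have "(\<Prod>i<N. q ^ Suc (n + j) - q ^ Suc j * q ^ i) =
     (-1) ^ N * q ^ (Suc j * N + (N choose 2)) * W N"
  proof -
    have "(\<Prod>i<N. q ^ Suc (n + j) - q ^ Suc j * q ^ i) =
       (\<Prod>i<N. (- (q ^ Suc j)) * q ^ i * (1 - q ^ Suc j * q ^ (N - Suc i)))"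
    proof (rule prod.cong)
      fix i assume "i \<in> {..<N}"
      then obtain d where "N = Suc i + d" using less_iff_Suc_add by auto
      then show "q ^ Suc (n + j) - q ^ Suc j * q ^ i =
        (- (q ^ Suc j)) * q ^ i * (1 - q ^ Suc j * q ^ (N - Suc i))"
        by (simp add: n power_add algebra_simps)
    qed simp
    also have "\<dots> = (- (q ^ Suc j)) ^ N * q ^ (N choose 2) * (\<Prod>i<N. 1 - q ^ Suc j * q ^ (N - Suc i))"
    proof -
      have "(\<Prod>i<N. q ^ i) = q ^ (N choose 2)"
        by (induction N) (simp_all add: choose_two_Suc power_add numeral_2_eq_2 mult.commute)
      then show ?thesis by (simp only: prod.distrib prod_constant card_lessThan)
    qed
    also have "(\<Prod>i<N. 1 - q ^ Suc j * q ^ (N - Suc i)) = W N"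
      unfolding W_def qpoch_def by (rule prod.nat_diff_reindex)
    also have "(- (q ^ Suc j)) ^ N = (-1) ^ N * q ^ (Suc j * N)"
      by (simp only: power_minus[of "q ^ Suc j" N] power_mult)
    finally show ?thesis by (simp add: power_add mult_ac)
  qed
  finally have total: "(\<Sum>i=j..n. legendre_coeff q n i * qbin q i j)
      = (-1) ^ n * qbin q n j * qbin q (n + j) j * q ^ ((N choose 2) + (Suc j * N + (N choose 2)))"
    using nzW[of N] by (simp add: n power_add mult_ac)
  have "(N choose 2) + (Suc j * N + (N choose 2)) + (Suc j choose 2)
     = (Suc n choose 2) + ((n - j) choose 2)"
    using choose_two_double[of N]
    by (simp add: n choose_two_Suc choose_two_add algebra_simps)
  then have exponents: "q ^ ((N choose 2) + (Suc j * N + (N choose 2))) * q ^ (Suc j choose 2)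
     = q ^ (Suc n choose 2) * q ^ ((n - j) choose 2)"
    by (simp only: power_add[symmetric])
  have rearrange: "x * a * b * e * s * y = x * a * b * y * (e * s)"
    "x * a * b * y * (t * d) = x * t * (y * d * a * b)" for x a b d e s t y :: complex
    by (simp_all add: mult_ac)
  show ?thesis
    unfolding total unfolding rearrange(1) exponents unfolding legendre_coeff_def by (rule rearrange(2))
qed

text \<open>The map \<open>x\<^sup>i \<mapsto> (xq)\<^sub>i\<close> is triangular; these are its eigenvectors.\<close>
lemma legendre_poly_eigen:
  assumes nz: "\<And>n. qpoch q q n \<noteq> 0"
  shows "(\<Sum>i\<le>n. legendre_coeff q n i * qpoch (x * q) q i)
     = (-1) ^ n * q ^ (Suc n choose 2) * legendre_poly q n x"
proof -
  have "(\<Sum>i\<le>n. legendre_coeff q n i * qpoch (x * q) q i)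
     = (\<Sum>i\<le>n. \<Sum>j\<le>i. legendre_coeff q n i * qbin q i j * q ^ (Suc j choose 2) * (-1) ^ j * x ^ j)"
    unfolding qbinomial_finite[of "x * q"] sum_distrib_left
    by (intro sum.cong) (simp_all add: choose_two_Suc power_add power_mult_distrib mult_ac)
  also have "\<dots> = (\<Sum>j\<le>n. \<Sum>i=j..n. legendre_coeff q n i * qbin q i j * q ^ (Suc j choose 2) * (-1) ^ j * x ^ j)"
    (is "(\<Sum>i\<le>n. sum (?t i) _) = _")
  proof -
    have "(\<Sum>i\<le>n. sum (?t i) {..i}) = (\<Sum>i\<le>n. sum (?t i) {j \<in> {..n}. j \<le> i})"
      by (intro sum.cong) auto
    also have "\<dots> = (\<Sum>j\<le>n. \<Sum>i | i \<in> {..n} \<and> j \<le> i. ?t i j)"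
      by (rule sum.swap_restrict) simp_all
    also have "\<dots> = (\<Sum>j\<le>n. \<Sum>i=j..n. ?t i j)"
      by (intro sum.cong) auto
    finally show ?thesis .
  qed
  also have "\<dots> = (\<Sum>j\<le>n. (\<Sum>i=j..n. legendre_coeff q n i * qbin q i j) * q ^ (Suc j choose 2) * (-1) ^ j * x ^ j)"
    by (simp add: sum_distrib_right)
  also have "\<dots> = (\<Sum>j\<le>n. (-1) ^ n * q ^ (Suc n choose 2) * legendre_coeff q n j * x ^ j)"
    by (rule sum.cong) (simp_all add: legendre_coeff_sum_qbin[OF nz])
  finally show ?thesis
    by (simp add: legendre_poly_def sum_distrib_left mult_ac)
qed

section \<open>Infinite products and \<open>q\<close>-series\<close>

lemma qpoch_nonzero:
  assumes "norm q < 1" "norm a < 1"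
  shows "qpoch a q n \<noteq> 0"
proof -
  have "a * q ^ i \<noteq> 1" for i
  proof
    assume "a * q ^ i = 1"
    then have "norm a * norm q ^ i = 1" by (metis norm_mult norm_one norm_power)
    moreover have "norm a * norm q ^ i \<le> norm a * 1"
      using assms by (intro mult_left_mono power_le_one) auto
    ultimately show False using assms by simp
  qed
  then show ?thesis by (simp add: qpoch_def)
qed

lemma convergent_prod_qpoch:
  assumes "norm q < 1"
  shows "convergent_prod (\<lambda>i. 1 - a * q ^ i :: complex)"
proof (rule abs_convergent_prod_imp_convergent_prod)
  show "abs_convergent_prod (\<lambda>i. 1 - a * q ^ i)"
    using assms
    by (simp add: abs_convergent_prod_conv_summable norm_mult norm_power summable_geometric)
qed

lemma qpoch_LIMSEQ:
  assumes "norm q < 1"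
  shows "qpoch a q \<longlonglongrightarrow> qpoch_inf a q"
  using convergent_prod_LIMSEQ[OF convergent_prod_qpoch[OF assms, of a]]
  by (subst filterlim_sequentially_Suc[symmetric]) (simp add: qpoch_def qpoch_inf_def lessThan_Suc_atMost)

lemma qpoch_inf_nonzero:
  assumes "norm q < 1" "norm a < 1"
  shows "qpoch_inf a q \<noteq> 0"
  unfolding qpoch_inf_def
proof (rule prodinf_nonzero[OF convergent_prod_qpoch[OF assms(1)]])
  fix i show "1 - a * q ^ i \<noteq> 0"
    using qpoch_nonzero[OF assms, of "Suc i"] by (simp add: qpoch_Suc)
qed

lemma qpoch_inf_split:
  assumes "norm q < 1"
  shows "qpoch_inf a q = qpoch a q n * qpoch_inf (a * q ^ n) q"
proof (rule LIMSEQ_unique)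
  show "(\<lambda>m. qpoch a q (n + m)) \<longlonglongrightarrow> qpoch_inf a q"
    using LIMSEQ_ignore_initial_segment[OF qpoch_LIMSEQ[OF assms, of a], of n] by (simp add: add.commute)
  show "(\<lambda>m. qpoch a q (n + m)) \<longlonglongrightarrow> qpoch a q n * qpoch_inf (a * q ^ n) q"
    unfolding qpoch_add by (intro tendsto_intros qpoch_LIMSEQ assms)
qed

lemma qpoch_inf_0 [simp]: "qpoch_inf 0 q = 1"
  by (simp add: qpoch_inf_def)

lemma qpoch_0_left [simp]: "qpoch 0 q n = 1"
  by (simp add: qpoch_def)

lemma qpoch_bounded:
  assumes "norm q < 1"
  obtains M where "M > 0" "\<And>n. norm (qpoch a q n) \<le> M"
  using convergent_imp_Bseq[OF convergentI[OF qpoch_LIMSEQ[OF assms, of a]]]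
  unfolding Bseq_def by blast

lemma inverse_qpoch_bounded:
  assumes "norm q < 1"
  obtains M where "M > 0" "\<And>n. norm (inverse (qpoch q q n)) \<le> M"
proof -
  have "(\<lambda>n. inverse (qpoch q q n)) \<longlonglongrightarrow> inverse (qpoch_inf q q)"
    by (intro tendsto_inverse qpoch_LIMSEQ qpoch_inf_nonzero assms)
  from convergent_imp_Bseq[OF convergentI[OF this]] show ?thesis
    using that unfolding Bseq_def by blast
qed

section \<open>Power series whose coefficients satisfy a first-order
  \<open>q\<close>-recurrence\<close>

context
  fixes q A B z :: complex and c :: "nat \<Rightarrow> complex"
  assumes q: "norm q < 1" and Az: "norm (A * z) < 1"
    and c0: "c 0 = 1" and c_Suc: "\<And>n. c (Suc n) * (1 - q ^ Suc n) = (A - B * q ^ n) * c n"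
begin

lemma one_minus_power_nonzero: "1 - q ^ Suc n \<noteq> 0"
  using qpoch_nonzero[OF q q, of "Suc n"] by (simp add: qpoch_Suc)

text \<open>The ratio of consecutive terms tends to \<open>A * z\<close>, and \<open>r\<close> is
  the midpoint between the norm of this limit and 1.\<close>

lemma q_series_summable_norm: "summable (\<lambda>n. norm (c n * z ^ n))"
proof -
  define r where "r = (1 + norm (A * z)) / 2"
  have r: "norm (A * z) < r" "r < 1" using Az by (simp_all add: r_def)
  have q0: "(\<lambda>n. q ^ n) \<longlonglongrightarrow> 0" using q by (rule LIMSEQ_power_zero)
  have "(\<lambda>n. norm ((A - B * q ^ n) / (1 - q * q ^ n) * z)) \<longlonglongrightarrow> norm ((A - B * 0) / (1 - q * 0) * z)"
    by (intro tendsto_intros q0) simp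
  then have "eventually (\<lambda>n. norm ((A - B * q ^ n) / (1 - q * q ^ n) * z) < r) sequentially"
    using r(1) by (auto dest: order_tendstoD)
  then obtain N where N: "\<And>n. n \<ge> N \<Longrightarrow> norm ((A - B * q ^ n) / (1 - q * q ^ n) * z) < r"
    by (auto simp: eventually_sequentially)
  show ?thesis
  proof (rule summable_ratio_test[OF r(2)])
    fix n assume n: "n \<ge> N"
    have "c (Suc n) * z ^ Suc n = ((A - B * q ^ n) / (1 - q * q ^ n) * z) * (c n * z ^ n)"
    proof -
      have "c (Suc n) = (A - B * q ^ n) / (1 - q * q ^ n) * c n"
        using c_Suc[of n] one_minus_power_nonzero[of n] by (simp add: eq_divide_eq)
      then show ?thesis by simp
    qed
    then have "norm (c (Suc n) * z ^ Suc n) \<le> r * norm (c n * z ^ n)"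
      using N[OF n] by (simp only: norm_mult) (intro mult_right_mono, auto)
    then show "norm (norm (c (Suc n) * z ^ Suc n)) \<le> r * norm (norm (c n * z ^ n))"
      by (simp only: real_norm_def abs_norm_cancel)
  qed
qed

text \<open>The recurrence for \<open>c\<close> gives
  \<open>(1 - A w) F(w) = (1 - B w) F(w q)\<close>. Iterating from \<open>z\<close> and using
  continuity of \<open>F\<close> at 0 with \<open>F 0 = 1\<close> yields the products. The choice
  \<open>A = 1\<close>, \<open>B = a\<close> is the \<open>q\<close>-binomial theorem;
  \<open>A = 0\<close>, \<open>B = 1\<close> is Euler's series for
  \<open>qpoch_inf z q\<close>.\<close>

lemma q_series_product: "(\<Sum>n. c n * z ^ n) * qpoch_inf (A * z) q = qpoch_inf (B * z) q"
proof -
  define F where "F w = (\<Sum>n. c n * w ^ n)" for w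
  have summ: "summable (\<lambda>n. c n * w ^ n)" if "norm w \<le> norm z" for w
  proof (rule summable_comparison_test'[OF q_series_summable_norm, of 0])
    show "norm (c n * w ^ n) \<le> norm (c n * z ^ n)" for n
      using that by (simp add: norm_mult norm_power mult_left_mono power_mono)
  qed
  have func: "(1 - A * w) * F w = (1 - B * w) * F (w * q)" if w: "norm w \<le> norm z" for w
  proof -
    have wq: "norm (w * q) \<le> norm z"
      using q w mult_mono[of "norm w" "norm z" "norm q" 1] by (simp add: norm_mult)
    have s1: "(\<lambda>n. c n * w ^ n) sums F w" and s2: "(\<lambda>n. c n * (w * q) ^ n) sums F (w * q)"
      unfolding F_def using summ[OF w] summ[OF wq] by (simp_all add: summable_sums)
    have "(\<lambda>n. c n * w ^ n - c n * (w * q) ^ n) sums (F w - F (w * q))"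
      by (rule sums_diff[OF s1 s2])
    then have 1: "(\<lambda>n. c (Suc n) * w ^ Suc n - c (Suc n) * (w * q) ^ Suc n) sums (F w - F (w * q))"
      by (subst sums_Suc_iff) simp
    have eq: "c (Suc n) * w ^ Suc n - c (Suc n) * (w * q) ^ Suc n =
       A * w * (c n * w ^ n) - B * w * (c n * (w * q) ^ n)" for n
    proof -
      have "c (Suc n) * w ^ Suc n - c (Suc n) * (w * q) ^ Suc n =
        (c (Suc n) * (1 - q ^ Suc n)) * w ^ Suc n"
        by (simp only: power_mult_distrib) (simp add: algebra_simps)
      also have "\<dots> = A * w * (c n * w ^ n) - B * w * (c n * (w * q) ^ n)"
        unfolding c_Suc power_mult_distrib by (simp add: algebra_simps)
      finally show ?thesis .
    qed
    have "(\<lambda>n. c (Suc n) * w ^ Suc n - c (Suc n) * (w * q) ^ Suc n) sums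
       (A * w * F w - B * w * F (w * q))"
      unfolding eq by (intro sums_diff sums_mult s1 s2)
    from sums_unique2[OF 1 this] show ?thesis by (simp add: algebra_simps)
  qed
  have qN: "norm (z * q ^ N) \<le> norm z" for N
    using q mult_left_mono[of "norm q ^ N" 1 "norm z"] by (simp add: norm_mult norm_power power_le_one)
  have iter: "qpoch (A * z) q N * F z = qpoch (B * z) q N * F (z * q ^ N)" for N
  proof (induction N)
    case (Suc N)
    have "qpoch (A * z) q (Suc N) * F z = (1 - A * (z * q ^ N)) * (qpoch (A * z) q N * F z)"
      by (simp add: qpoch_Suc)
    also have "\<dots> = (1 - A * (z * q ^ N)) * (qpoch (B * z) q N * F (z * q ^ N))"
      by (simp only: Suc)
    also have "\<dots> = qpoch (B * z) q N * ((1 - A * (z * q ^ N)) * F (z * q ^ N))"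
      by (simp only: mult_ac)
    also have "\<dots> = qpoch (B * z) q (Suc N) * F (z * q ^ Suc N)"
      unfolding func[OF qN] by (simp add: qpoch_Suc mult_ac)
    finally show ?case .
  qed simp
  have F0: "F 0 = 1"
    unfolding F_def by (simp add: powser_zero c0)
  have "(\<lambda>N. F (z * q ^ N)) \<longlonglongrightarrow> 1"
  proof (cases "z = 0")
    case False
    then have "isCont F 0"
      unfolding F_def by (intro isCont_powser[of c z] summ) auto
    moreover have "(\<lambda>N. z * q ^ N) \<longlonglongrightarrow> z * 0"
      using q by (intro tendsto_intros LIMSEQ_power_zero)
    ultimately show ?thesis
      using isCont_tendsto_compose[of 0 F "\<lambda>N. z * q ^ N"] F0 by simp
  qed (simp add: F0)
  then have right: "(\<lambda>N. qpoch (B * z) q N * F (z * q ^ N)) \<longlonglongrightarrow> qpoch_inf (B * z) q * 1"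
    by (intro tendsto_mult qpoch_LIMSEQ q)
  have left: "(\<lambda>N. qpoch (A * z) q N * F z) \<longlonglongrightarrow> qpoch_inf (A * z) q * F z"
    by (intro tendsto_mult tendsto_const qpoch_LIMSEQ q)
  have "qpoch_inf (A * z) q * F z = qpoch_inf (B * z) q * 1"
    using LIMSEQ_unique[OF left] right unfolding iter by blast
  then show ?thesis by (simp add: F_def mult.commute)
qed

end

lemma q_binomial_theorem:
  assumes q: "norm q < 1" and z: "norm z < 1"
  shows "summable (\<lambda>m. norm (qpoch a q m / qpoch q q m * z ^ m))"
    and "(\<lambda>m. qpoch a q m / qpoch q q m * z ^ m) sums (qpoch_inf (a * z) q / qpoch_inf z q)"
proof -
  have rec: "qpoch a q (Suc n) / qpoch q q (Suc n) * (1 - q ^ Suc n) =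
      (1 - a * q ^ n) * (qpoch a q n / qpoch q q n)" for n
    using qpoch_nonzero[OF q q, of "Suc n"] by (simp add: qpoch_Suc)
  have start: "qpoch a q 0 / qpoch q q 0 = 1" by simp
  have z': "norm (1 * z) < 1" using z by simp
  show *: "summable (\<lambda>m. norm (qpoch a q m / qpoch q q m * z ^ m))"
    by (rule q_series_summable_norm[OF q z' start rec])
  show "(\<lambda>m. qpoch a q m / qpoch q q m * z ^ m) sums (qpoch_inf (a * z) q / qpoch_inf z q)"
    using q_series_product[OF q z' start rec] summable_norm_cancel[OF *] qpoch_inf_nonzero[OF q z]
    by (simp add: sums_iff field_simps)
qed

lemma euler_q_exponential:
  assumes q: "norm q < 1"
  shows "summable (\<lambda>m. norm ((-1) ^ m * q ^ (m choose 2) / qpoch q q m * z ^ m))"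
    and "(\<lambda>m. (-1) ^ m * q ^ (m choose 2) / qpoch q q m * z ^ m) sums qpoch_inf z q"
proof -
  have rec: "(-1) ^ Suc n * q ^ (Suc n choose 2) / qpoch q q (Suc n) * (1 - q ^ Suc n) =
      (0 - 1 * q ^ n) * ((-1) ^ n * q ^ (n choose 2) / qpoch q q n)" for n
    using qpoch_nonzero[OF q q, of "Suc n"] by (simp add: qpoch_Suc choose_two_Suc power_add)
  have start: "(-1) ^ 0 * q ^ (0 choose 2) / qpoch q q 0 = 1" by simp
  have z': "norm (0 * z) < 1" by simp
  show *: "summable (\<lambda>m. norm ((-1) ^ m * q ^ (m choose 2) / qpoch q q m * z ^ m))"
    by (rule q_series_summable_norm[OF q z' start rec])
  show "(\<lambda>m. (-1) ^ m * q ^ (m choose 2) / qpoch q q m * z ^ m) sums qpoch_inf z q"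
    using q_series_product[OF q z' start rec] summable_norm_cancel[OF *]
    by (simp add: sums_iff)
qed

text \<open>At \<open>x = q^m\<close> the monomial \<open>x^i\<close> produces a
  \<open>q\<close>-binomial series with argument \<open>q^(i+1)\<close>, whose value is a constant
  times \<open>(q)_i / (a q)_i\<close>; then \<open>legendre_coeff_chu\<close> applies. The bound on
  \<open>a\<close> makes \<open>(a q)_n\<close> nonzero.\<close>

lemma legendre_poly_moment:
  assumes q: "norm q < 1" and a: "norm a \<le> 1"
  shows "(\<lambda>m. q ^ m * qpoch a q m / qpoch q q m * legendre_poly q n (q ^ m)) sums
    (qpoch_inf (a * q) q / qpoch_inf q q *
      (q ^ (n choose 2) * (\<Prod>i<n. q ^ Suc n - a * q * q ^ i) / qpoch (a * q) q n))"
proof -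
  have aq: "norm (a * q) < 1"
    using q a mult_mono[of "norm a" 1 "norm q" "norm q"] by (simp add: norm_mult)
  have "(\<lambda>m. \<Sum>i\<le>n. legendre_coeff q n i * (qpoch a q m / qpoch q q m * (q ^ Suc i) ^ m)) sums
     (\<Sum>i\<le>n. legendre_coeff q n i * (qpoch_inf (a * q ^ Suc i) q / qpoch_inf (q ^ Suc i) q))"
    by (intro sums_sum sums_mult q_binomial_theorem q)
      (use q in \<open>simp add: norm_power power_less_one_iff del: power_Suc\<close>)
  moreover have lhs: "(\<Sum>i\<le>n. legendre_coeff q n i * (qpoch a q m / qpoch q q m * (q ^ Suc i) ^ m)) =
      q ^ m * qpoch a q m / qpoch q q m * legendre_poly q n (q ^ m)" for m
    by (simp add: legendre_poly_def sum_distrib_left sum_divide_distrib power_mult_distrib mult_ac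
        flip: power_mult)
  moreover have rhs: "qpoch_inf (a * q ^ Suc i) q / qpoch_inf (q ^ Suc i) q =
     qpoch_inf (a * q) q / qpoch_inf q q * (qpoch q q i / qpoch (a * q) q i)" for i
    using qpoch_nonzero[OF q aq, of i] qpoch_nonzero[OF q q, of i] qpoch_inf_nonzero[OF q q]
      qpoch_inf_split[OF q, of "a * q" i] qpoch_inf_split[OF q, of q i]
    by (simp add: mult_ac)
  ultimately have "(\<lambda>m. q ^ m * qpoch a q m / qpoch q q m * legendre_poly q n (q ^ m)) sums
    (\<Sum>i\<le>n. legendre_coeff q n i * (qpoch_inf (a * q) q / qpoch_inf q q * (qpoch q q i / qpoch (a * q) q i)))"
    by (simp only: lhs rhs)
  also have "(\<Sum>i\<le>n. legendre_coeff q n i * (qpoch_inf (a * q) q / qpoch_inf q q * (qpoch q q i / qpoch (a * q) q i)))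
    = qpoch_inf (a * q) q / qpoch_inf q q *
     (\<Sum>i\<le>n. legendre_coeff q n i * (qpoch q q i / qpoch (a * q) q i))"
    unfolding sum_distrib_left by (intro sum.cong refl mult.left_commute)
  finally show ?thesis
    unfolding legendre_coeff_chu[OF qpoch_nonzero[OF q q] qpoch_nonzero[OF q aq]] .
qed

text \<open>The eigenvalue equation of the kernel, with one factor \<open>(q)_n\<close> already
  cancelled. The monomial \<open>x^i\<close> yields the \<open>q\<close>-binomial series with
  \<open>a = 0\<close> at \<open>q^(m+i+1)\<close>, that is
  \<open>(q)_m (q^(m+1))_i / (q)_\<infinity>\<close>, to which \<open>legendre_poly_eigen\<close>
  applies.\<close>

lemma legendre_poly_kernel:
  assumes q: "norm q < 1"
  shows "(\<lambda>n. q ^ (m * n + n) / qpoch q q n * legendre_poly q v (q ^ n)) sums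
    ((-1) ^ v * q ^ (Suc v choose 2) / qpoch_inf q q * (qpoch q q m * legendre_poly q v (q ^ m)))"
proof -
  have "(\<lambda>n. \<Sum>i\<le>v. legendre_coeff q v i * (qpoch 0 q n / qpoch q q n * (q ^ Suc (m + i)) ^ n)) sums
     (\<Sum>i\<le>v. legendre_coeff q v i * (qpoch_inf (0 * q ^ Suc (m + i)) q / qpoch_inf (q ^ Suc (m + i)) q))"
    by (intro sums_sum sums_mult q_binomial_theorem q)
      (use q in \<open>simp add: norm_power power_less_one_iff del: power_Suc\<close>)
  moreover have lhs: "(\<Sum>i\<le>v. legendre_coeff q v i * (qpoch 0 q n / qpoch q q n * (q ^ Suc (m + i)) ^ n)) =
      q ^ (m * n + n) / qpoch q q n * legendre_poly q v (q ^ n)" for n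
    by (simp add: legendre_poly_def sum_distrib_left sum_divide_distrib power_mult_distrib power_add mult_ac
        flip: power_mult)
  moreover have rhs: "qpoch_inf (0 * q ^ Suc (m + i)) q / qpoch_inf (q ^ Suc (m + i)) q =
     qpoch q q m / qpoch_inf q q * qpoch (q ^ m * q) q i" for i
  proof -
    have "qpoch_inf q q = qpoch q q m * qpoch (q ^ m * q) q i * qpoch_inf (q ^ Suc (m + i)) q"
      using qpoch_inf_split[OF q, of q "m + i"] by (simp add: qpoch_add mult_ac)
    then show ?thesis using qpoch_inf_nonzero[OF q q] by simp
  qed
  ultimately have "(\<lambda>n. q ^ (m * n + n) / qpoch q q n * legendre_poly q v (q ^ n)) sums
    (\<Sum>i\<le>v. legendre_coeff q v i * (qpoch q q m / qpoch_inf q q * qpoch (q ^ m * q) q i))"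
    by (simp only: lhs rhs)
  also have "(\<Sum>i\<le>v. legendre_coeff q v i * (qpoch q q m / qpoch_inf q q * qpoch (q ^ m * q) q i))
    = qpoch q q m / qpoch_inf q q * (\<Sum>i\<le>v. legendre_coeff q v i * qpoch (q ^ m * q) q i)"
    unfolding sum_distrib_left by (intro sum.cong refl mult.left_commute)
  also have "\<dots> = (-1) ^ v * q ^ (Suc v choose 2) / qpoch_inf q q * (qpoch q q m * legendre_poly q v (q ^ m))"
    unfolding legendre_poly_eigen[OF qpoch_nonzero[OF q q]] by (simp add: mult_ac)
  finally show ?thesis .
qed

section \<open>Expansion in little \<open>q\<close>-Legendre polynomials\<close>

text \<open>Zeilberger's algorithm supplies the telescoping part \<open>g\<close>.\<close>
lemma q_telescoping_sum:
  assumes q: "norm q < 1"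
  shows "(\<lambda>s. q ^ (s * (s + i)) * (1 - q ^ (2 * (i + s) + 1)) * qpoch q q (2 * i + s) / qpoch q q s)
    sums qpoch q q i"
proof (induction i)
  case 0
  \<comment> \<open>For \<open>i = 0\<close> the factor \<open>1 - q^(2s+1)\<close> turns the
    summand into a difference of consecutive powers \<open>q^(s^2)\<close>.\<close>
  have "(\<lambda>s. q ^ (s * s)) \<longlonglongrightarrow> 0"
  proof (rule Lim_null_comparison)
    show "\<forall>\<^sub>F s in sequentially. norm (q ^ (s * s)) \<le> norm q ^ s"
      using q by (intro always_eventually allI) (simp add: norm_power power_decreasing)
    show "(\<lambda>s. norm q ^ s) \<longlonglongrightarrow> 0" using q by (simp add: LIMSEQ_power_zero)
  qed
  from telescope_sums'[OF this]
  have "(\<lambda>s. q ^ (s * s) - q ^ (Suc s * Suc s)) sums (1 - 0)" by simp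
  moreover have "q ^ (s * (s + 0)) * (1 - q ^ (2 * (0 + s) + 1)) * qpoch q q (2 * 0 + s) / qpoch q q s
     = q ^ (s * s) - q ^ (Suc s * Suc s)" for s
  proof -
    have "Suc s * Suc s = s * s + (2 * s + 1)" by simp
    then have square: "q ^ (Suc s * Suc s) = q ^ (s * s) * q ^ (2 * s + 1)" by (simp only: power_add)
    show ?thesis
      unfolding square using qpoch_nonzero[OF q q, of s] by (simp add: right_diff_distrib)
  qed
  ultimately show ?case by simp
next
  case (Suc i)
  define T where "T i s = q ^ (s * (s + i)) * (1 - q ^ (2 * (i + s) + 1))
     * qpoch q q (2 * i + s) / qpoch q q s" for i s
  define g where "g s = q ^ (s * (s + 1 + i)) * (1 - q ^ (i + s + 1))
     * qpoch q q (2 * i + s + 1) / qpoch q q s" for s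
  have nz: "qpoch q q n \<noteq> 0" for n by (rule qpoch_nonzero[OF q q])
  have nz': "1 - q * q ^ n \<noteq> 0" for n using nz[of "Suc n"] by (simp add: qpoch_Suc)
  have step: "T (Suc i) s = (1 - q ^ Suc i) * T i (Suc s) + (g s - g (Suc s))" for s
  proof -
    \<comment> \<open>Once the common factor \<open>C\<close> is taken out, the recurrence is a
      polynomial identity in \<open>q\<close>, \<open>X = q^s\<close> and
      \<open>w = q^i\<close>.\<close>
    define C where "C = q ^ (s * (s + i + 1)) * qpoch q q (2 * i + s + 1) / qpoch q q (Suc s)"
    have 1: "T (Suc i) s = C * (1 - q ^ (2 * i + 2 * s + 3)) * (1 - q ^ (2 * i + s + 2)) * (1 - q ^ (s + 1))"
      using nz[of s] nz'[of s]
      by (simp add: T_def C_def qpoch_Suc eval_nat_numeral add_ac mult_ac)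
    have 2: "T i (Suc s) = C * q ^ (s + 1 + i) * (1 - q ^ (2 * i + 2 * s + 3))"
      by (simp add: T_def C_def power_add eval_nat_numeral algebra_simps)
    have 3: "g s = C * (1 - q ^ (s + 1)) * (1 - q ^ (i + s + 1))"
      using nz[of s] nz'[of s] by (simp add: g_def C_def qpoch_Suc add_ac mult_ac)
    have 4: "g (Suc s) = C * q ^ (2 * s + 2 + i) * (1 - q ^ (2 * i + s + 2)) * (1 - q ^ (i + s + 2))"
      by (simp add: g_def C_def qpoch_Suc power_add eval_nat_numeral add_ac mult_ac algebra_simps)
    define X where "X = q ^ s"
    define w where "w = q ^ i"
    show ?thesis
      unfolding 1 2 3 4
      by (simp add: power_add power_mult eval_nat_numeral flip: X_def w_def)
        (simp add: algebra_simps)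
  qed
  have "g \<longlonglongrightarrow> 0"
  proof -
    have "(\<lambda>s. q ^ (s * (s + 1 + i))) \<longlonglongrightarrow> 0"
    proof (rule Lim_null_comparison)
      show "\<forall>\<^sub>F s in sequentially. norm (q ^ (s * (s + 1 + i))) \<le> norm q ^ s"
        using q by (intro always_eventually allI) (simp add: norm_power power_decreasing)
      show "(\<lambda>s. norm q ^ s) \<longlonglongrightarrow> 0" using q by (simp add: LIMSEQ_power_zero)
    qed
    moreover have "(\<lambda>s. q ^ (i + s + 1)) \<longlonglongrightarrow> 0"
      using LIMSEQ_ignore_initial_segment[OF LIMSEQ_power_zero[OF q], of "i + 1"] by (simp add: add_ac)
    moreover have "(\<lambda>s. qpoch q q (2 * i + s + 1)) \<longlonglongrightarrow> qpoch_inf q q"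
      using LIMSEQ_ignore_initial_segment[OF qpoch_LIMSEQ[OF q, of q], of "2 * i + 1"]
      by (simp add: add_ac)
    ultimately have "g \<longlonglongrightarrow> 0 * (1 - 0) * qpoch_inf q q / qpoch_inf q q"
      unfolding g_def by (intro tendsto_intros qpoch_LIMSEQ q qpoch_inf_nonzero)
    then show ?thesis by simp
  qed
  from telescope_sums'[OF this] have "(\<lambda>s. g s - g (Suc s)) sums g 0" by simp
  \<comment> \<open>The recurrence involves \<open>T i\<close> at \<open>s + 1\<close>, so the sum
    of \<open>T i\<close> loses its first term; the boundary value \<open>g 0\<close> restores
    exactly that term.\<close>
  moreover have "T i sums qpoch q q i" using Suc unfolding T_def .
  then have "(\<lambda>s. T i (Suc s)) sums (qpoch q q i - T i 0)"
    by (subst sums_Suc_iff) simp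
  ultimately have "T (Suc i) sums ((1 - q ^ Suc i) * (qpoch q q i - T i 0) + g 0)"
    unfolding step by (intro sums_add sums_mult)
  moreover have "g 0 = (1 - q ^ Suc i) * T i 0"
    by (simp add: g_def T_def qpoch_Suc algebra_simps)
  ultimately have "T (Suc i) sums ((1 - q ^ Suc i) * qpoch q q i)"
    by (simp add: right_diff_distrib)
  moreover have "(1 - q ^ Suc i) * qpoch q q i = qpoch q q (Suc i)"
    by (simp add: qpoch_Suc)
  ultimately have "T (Suc i) sums qpoch q q (Suc i)" by simp
  then show ?case unfolding T_def .
qed

section \<open>Bounds that justify interchanging sums\<close>

lemma norm_summable_on_Times:
  fixes f :: "'a \<Rightarrow> complex" and g :: "'b \<Rightarrow> complex"
  assumes f: "(\<lambda>x. norm (f x)) summable_on A" and g: "(\<lambda>y. norm (g y)) summable_on B"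
  shows "(\<lambda>p. norm (f (fst p) * g (snd p))) summable_on A \<times> B"
proof (subst Infinite_Sum.abs_summable_on_Sigma_iff, intro conjI ballI)
  show "(\<lambda>y. norm (f (fst (x, y)) * g (snd (x, y)))) summable_on B" for x
    using g by (simp add: norm_mult summable_on_cmult_right)
  have "(\<lambda>x. norm (f x) * (\<Sum>\<^sub>\<infinity>y\<in>B. norm (g y))) summable_on A"
    by (intro summable_on_cmult_left f)
  then show "(\<lambda>x. norm (\<Sum>\<^sub>\<infinity>y\<in>B. norm (f (fst (x, y)) * g (snd (x, y))))) summable_on A"
    by (simp add: norm_mult infsum_cmult_right' infsum_nonneg abs_mult)
qed

text \<open>The sequence \<open>(q)_n\<close> and its inverse are bounded because the limit
  \<open>(q)_\<infinity>\<close> is nonzero. Hence the Gaussian binomials are bounded uniformly in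
  both arguments.\<close>

lemma legendre_coeff_bounded:
  assumes q: "norm q < 1"
  obtains M where "M > 0" "\<And>n i. norm (legendre_coeff q n i) \<le> M"
proof -
  obtain U where U: "U > 0" "\<And>n. norm (qpoch q q n) \<le> U" using qpoch_bounded[OF q] by metis
  obtain V where V: "V > 0" "\<And>n. norm (inverse (qpoch q q n)) \<le> V"
    using inverse_qpoch_bounded[OF q] by metis
  define D where "D = U * (V * V)"
  have D: "D > 0" using U V by (simp add: D_def)
  have nz: "qpoch q q n \<noteq> 0" for n by (rule qpoch_nonzero[OF q q])
  have bin: "norm (qbin q n k) \<le> D" for n k
  proof (cases "k \<le> n")
    case True
    have "qbin q n k = qpoch q q n * (inverse (qpoch q q k) * inverse (qpoch q q (n - k)))"
      using qbin_qpoch[OF True, of q] nz[of k] nz[of "n - k"] by (simp add: field_simps)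
    then have "norm (qbin q n k) = norm (qpoch q q n) *
        (norm (inverse (qpoch q q k)) * norm (inverse (qpoch q q (n - k))))"
      by (simp only: norm_mult)
    also have "\<dots> \<le> U * (V * V)"
      using U V by (intro mult_mono) auto
    finally show ?thesis by (simp add: D_def)
  qed (use D in \<open>simp add: qbin_eq_0\<close>)
  have "norm (legendre_coeff q n i) \<le> 1 * D * D" for n i
    unfolding legendre_coeff_def norm_mult norm_power
    using q D by (intro mult_mono bin) (auto simp: power_le_one)
  with that[of "1 * D * D"] D show ?thesis by simp
qed

lemma legendre_coeff_eq_0: "n < i \<Longrightarrow> legendre_coeff q n i = 0"
  by (simp add: legendre_coeff_def qbin_eq_0)

lemma legendre_poly_bounded:
  assumes q: "norm q < 1"
  obtains M where "M > 0" "\<And>v x. norm x \<le> 1 \<Longrightarrow> norm (legendre_poly q v x) \<le> M * real (Suc v)"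
proof -
  obtain M where M: "M > 0" "\<And>n i. norm (legendre_coeff q n i) \<le> M"
    using legendre_coeff_bounded[OF q] by metis
  have "norm (legendre_poly q v x) \<le> M * real (Suc v)" if "norm x \<le> 1" for v x
  proof -
    have "norm (legendre_poly q v x) \<le> (\<Sum>i\<le>v. M * 1)"
      unfolding legendre_poly_def
    proof (intro order_trans[OF norm_sum] sum_mono)
      show "norm (legendre_coeff q v i * x ^ i) \<le> M * 1" for i
        unfolding norm_mult norm_power using M that by (intro mult_mono) (auto simp: power_le_one)
    qed
    then show ?thesis by (simp add: mult.commute)
  qed
  with that M show ?thesis by blast
qed

text \<open>Expanding the polynomials in powers of \<open>x\<close> and interchanging the sums
  reduces the coefficient of \<open>x^i\<close> to \<open>q_telescoping_sum\<close>; what remains is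
  Euler's series for \<open>(x q)_\<infinity>\<close>.\<close>

lemma legendre_expansion:
  assumes q: "norm q < 1" and x: "norm x \<le> 1"
  shows "((\<lambda>v. q ^ (Suc v choose 2) * (1 - q ^ (2 * v + 1)) * legendre_poly q v x)
    has_sum qpoch_inf (x * q) q) UNIV"
proof -
  obtain M where M: "M > 0" "\<And>n i. norm (legendre_coeff q n i) \<le> M"
    using legendre_coeff_bounded[OF q] by metis
  \<comment> \<open>The square root splits the decay: for \<open>i \<le> v\<close> one has
    \<open>|q|^v = \<rho>^v \<rho>^v \<le> \<rho>^v \<rho>^i\<close>, so a product of two geometric
    series dominates the double series.\<close>
  define \<rho> where "\<rho> = sqrt (norm q)"
  have \<rho>: "0 \<le> \<rho>" "\<rho> < 1" "\<rho> * \<rho> = norm q" using q by (simp_all add: \<rho>_def)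
  define t where "t v i = q ^ (Suc v choose 2) * (1 - q ^ (2 * v + 1)) * (legendre_coeff q v i * x ^ i)"
    for v i
  have nz: "qpoch q q n \<noteq> 0" for n by (rule qpoch_nonzero[OF q q])
  have bound: "norm (t v i) \<le> norm ((of_real (2 * M * \<rho> ^ v) * of_real (\<rho> ^ i)) :: complex)" for v i
  proof (cases "i \<le> v")
    case True
    have "norm q ^ (Suc v choose 2) \<le> norm q ^ v"
      using q by (intro power_decreasing) (auto simp: choose_two_Suc)
    also have "\<dots> = \<rho> ^ v * \<rho> ^ v" using \<rho> by (metis power_mult_distrib)
    also have "\<dots> \<le> \<rho> ^ v * \<rho> ^ i"
      using \<rho> True by (intro mult_left_mono power_decreasing) auto
    finally have 1: "norm q ^ (Suc v choose 2) \<le> \<rho> ^ v * \<rho> ^ i" .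
    have "norm (1 - q ^ (2 * v + 1)) \<le> 1 + norm q ^ (2 * v + 1)"
      by (metis norm_one norm_power norm_triangle_ineq4)
    also have "\<dots> \<le> 2" using q power_le_one[of "norm q" "2 * v + 1"] by auto
    finally have 2: "norm (1 - q ^ (2 * v + 1)) \<le> 2" .
    have 3: "norm (legendre_coeff q v i) * norm x ^ i \<le> M * 1"
      using M x by (intro mult_mono) (auto simp: power_le_one)
    have "norm (t v i) \<le> (\<rho> ^ v * \<rho> ^ i) * 2 * (M * 1)"
      unfolding t_def norm_mult norm_power using \<rho> M
      by (intro mult_mono 1 3 2) auto
    also have "\<dots> = norm ((of_real (2 * M * \<rho> ^ v) * of_real (\<rho> ^ i)) :: complex)"
      using \<rho> M by (simp add: norm_mult norm_power)
    finally show ?thesis .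
  qed (simp add: t_def legendre_coeff_eq_0)
  have geo: "(\<lambda>v. norm (of_real (2 * M * \<rho> ^ v) :: complex)) summable_on UNIV"
    "(\<lambda>v. norm (of_real (\<rho> ^ v) :: complex)) summable_on UNIV"
    using \<rho> M
    by (intro norm_summable_imp_summable_on;
        simp add: norm_mult norm_power abs_mult summable_geometric summable_mult)+
  have "(\<lambda>p. norm (t (fst p) (snd p))) summable_on UNIV \<times> UNIV"
    by (rule Infinite_Sum.abs_summable_on_comparison_test[OF norm_summable_on_Times[OF geo]])
      (rule bound)
  then have summ: "(\<lambda>(v, i). t v i) summable_on UNIV \<times> UNIV"
    unfolding case_prod_unfold by (rule abs_summable_summable)
  then have summ': "(\<lambda>(i, v). t v i) summable_on UNIV \<times> UNIV"
    unfolding summable_on_swap[of "\<lambda>(v, i). t v i" UNIV UNIV] by simp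
  have rows: "(\<Sum>\<^sub>\<infinity>i. t v i) = q ^ (Suc v choose 2) * (1 - q ^ (2 * v + 1)) * legendre_poly q v x" for v
  proof -
    have "(\<Sum>\<^sub>\<infinity>i. t v i) = (\<Sum>\<^sub>\<infinity>i\<in>{..v}. t v i)"
      by (rule infsum_cong_neutral) (auto simp: t_def legendre_coeff_eq_0)
    then show ?thesis by (simp add: t_def legendre_poly_def sum_distrib_left)
  qed
  have columns: "(\<Sum>\<^sub>\<infinity>v. t v i) = (-1) ^ i * q ^ (i choose 2) / qpoch q q i * (x * q) ^ i" for i
  proof -
    \<comment> \<open>Terms with \<open>v < i\<close> vanish, so \<open>v = s + i\<close>. The two
      triangular exponents combine to \<open>(i + 1 choose 2) + s (s + i)\<close>.\<close>
    have "t (s + i) i = (-1) ^ i * q ^ (Suc i choose 2) * x ^ i / (qpoch q q i)\<^sup>2 *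
       (q ^ (s * (s + i)) * (1 - q ^ (2 * (i + s) + 1)) * qpoch q q (2 * i + s) / qpoch q q s)" for s
    proof -
      have b1: "qbin q (s + i) i = qpoch q q (s + i) / (qpoch q q i * qpoch q q s)"
        using qbin_qpoch[of i "s + i" q] nz by (simp add: eq_divide_eq)
      have b2: "qbin q (s + i + i) i = qpoch q q (2 * i + s) / (qpoch q q i * qpoch q q (s + i))"
        using qbin_qpoch[of i "s + i + i" q] nz by (simp add: eq_divide_eq add_ac mult_2)
      have "(Suc (s + i) choose 2) + (s choose 2) = (Suc i choose 2) + s * (s + i)"
        using choose_two_double[of s] by (simp add: choose_two_Suc choose_two_add algebra_simps)
      then have e: "q ^ (Suc (s + i) choose 2) * q ^ (s choose 2) = q ^ (Suc i choose 2) * q ^ (s * (s + i))"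
        by (simp only: power_add[symmetric])
      have "t (s + i) i = (q ^ (Suc (s + i) choose 2) * q ^ (s choose 2)) * (-1) ^ i * x ^ i *
         (1 - q ^ (2 * (i + s) + 1)) * (qbin q (s + i) i * qbin q (s + i + i) i)"
        by (simp add: t_def legendre_coeff_def add_ac mult_ac)
      then show ?thesis unfolding e b1 b2
        using nz[of "s + i"] by (simp add: power2_eq_square mult_ac)
    qed
    then have "(\<lambda>s. t (s + i) i) sums ((-1) ^ i * q ^ (Suc i choose 2) * x ^ i / (qpoch q q i)\<^sup>2 * qpoch q q i)"
      by (simp only:) (intro sums_mult q_telescoping_sum q)
    then have "(\<lambda>v. t v i) sums ((-1) ^ i * q ^ (Suc i choose 2) * x ^ i / (qpoch q q i)\<^sup>2 * qpoch q q i)"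
      by (subst (asm) sums_zero_iff_shift) (auto simp: t_def legendre_coeff_eq_0)
    moreover have "(\<lambda>v. t v i) summable_on UNIV"
      using summable_on_SigmaD1[of "\<lambda>i v. t v i" UNIV "\<lambda>_. UNIV" i] summ' by simp
    ultimately have "(\<Sum>\<^sub>\<infinity>v. t v i) = (-1) ^ i * q ^ (Suc i choose 2) * x ^ i / (qpoch q q i)\<^sup>2 * qpoch q q i"
      by (meson has_sum_imp_sums has_sum_infsum sums_unique2)
    then show ?thesis
      using nz[of i] by (simp add: power2_eq_square choose_two_Suc power_add power_mult_distrib mult_ac)
  qed
  have "(\<Sum>\<^sub>\<infinity>v. \<Sum>\<^sub>\<infinity>i. t v i) = (\<Sum>\<^sub>\<infinity>i. \<Sum>\<^sub>\<infinity>v. t v i)"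
    by (rule infsum_swap_banach[OF summ])
  also have "\<dots> = qpoch_inf (x * q) q"
    unfolding columns
    by (rule infsumI, rule norm_summable_imp_has_sum) (rule euler_q_exponential[OF q])+
  finally have "(\<Sum>\<^sub>\<infinity>v. \<Sum>\<^sub>\<infinity>i. t v i) = qpoch_inf (x * q) q" .
  moreover have "(\<lambda>v. \<Sum>\<^sub>\<infinity>i. t v i) summable_on UNIV"
    by (rule summable_on_Sigma_banach) (use summ in simp)
  ultimately have "((\<lambda>v. \<Sum>\<^sub>\<infinity>i. t v i) has_sum qpoch_inf (x * q) q) UNIV"
    by (metis has_sum_infsum)
  then show ?thesis by (simp only: rows)
qed

section \<open>The chain sum\<close>

text \<open>Contribution of a variable \<open>n\<close> whose left neighbour is \<open>m\<close>.
  The first variable has no left neighbour and corresponds to \<open>m = 0\<close>.\<close>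

definition chain_weight :: "complex \<Rightarrow> nat \<Rightarrow> nat \<Rightarrow> complex" where
  "chain_weight q m n = q ^ (m * n + n) / (qpoch q q n)\<^sup>2"

text \<open>A new last variable is coupled only to its left neighbour, while the factor
  \<open>qpoch a q (n 1)\<close> sits at the other end. The sum can thus be built by applying the
  kernel once per variable.\<close>

lemma chain_term_fun_upd:
  assumes "k \<ge> 1"
  shows "chain_term (Suc k) a q (n(Suc k := j)) = chain_term k a q n * chain_weight q (n k) j"
proof -
  define n' where "n' = n(Suc k := j)"
  have n': "n' i = n i" if "i \<le> k" for i using that by (simp add: n'_def)
  have n'_Suc: "n' (Suc k) = j" by (simp add: n'_def)
  have "(\<Sum>i=1..<Suc k. n' i * n' (Suc i)) = (\<Sum>i=1..<k. n i * n (Suc i)) + n k * j"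
    using assms by (simp add: n' n'_Suc)
  moreover have "(\<Sum>i=1..Suc k. n' i) = (\<Sum>i=1..k. n i) + j"
    by (simp add: n' n'_Suc)
  ultimately have "chain_exponent (Suc k) n' = chain_exponent k n + (n k * j + j)"
    by (simp add: chain_exponent_def)
  moreover have "(\<Prod>i=1..Suc k. (qpoch q q (n' i))\<^sup>2) = (\<Prod>i=1..k. (qpoch q q (n i))\<^sup>2) * (qpoch q q j)\<^sup>2"
    by (simp add: n' n'_Suc)
  moreover have "n' 1 = n 1" using assms by (simp add: n')
  ultimately show ?thesis
    unfolding n'_def[symmetric] chain_term_def chain_weight_def by (simp add: power_add)
qed

lemma bij_betw_PiE_Suc:
  "bij_betw (\<lambda>p. (fst p)(Suc k := snd p)) (({1..k} \<rightarrow>\<^sub>E UNIV) \<times> UNIV) ({1..Suc k} \<rightarrow>\<^sub>E UNIV)"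
  by (rule bij_betw_byWitness[where f' = "\<lambda>n. (restrict n {1..k}, n (Suc k))"])
    (auto simp: fun_eq_iff PiE_iff extensional_def restrict_def)

lemma bij_betw_PiE_1:
  "bij_betw (\<lambda>j. (\<lambda>_. undefined)(1 := j)) UNIV ({1..1::nat} \<rightarrow>\<^sub>E UNIV)"
  by (rule bij_betw_byWitness[where f' = "\<lambda>n. n 1"])
    (auto simp: fun_eq_iff PiE_iff extensional_def split: if_splits)

lemma chain_term_1: "chain_term 1 a q ((\<lambda>_. undefined)(1 := j)) = qpoch a q j * chain_weight q 0 j"
  by (simp add: chain_term_def chain_exponent_def chain_weight_def)

lemma chain_weight_summable:
  assumes q: "norm q < 1"
  shows "(\<lambda>n. norm (chain_weight q 0 n)) summable_on UNIV"
proof -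
  obtain V where V: "V > 0" "\<And>n. norm (inverse (qpoch q q n)) \<le> V"
    using inverse_qpoch_bounded[OF q] by metis
  have "norm (chain_weight q 0 n) \<le> norm q ^ n * (V * V)" for n
  proof -
    have "chain_weight q 0 n = q ^ n * (inverse (qpoch q q n) * inverse (qpoch q q n))"
      by (simp add: chain_weight_def power2_eq_square divide_inverse)
    then have "norm (chain_weight q 0 n) =
       norm q ^ n * (norm (inverse (qpoch q q n)) * norm (inverse (qpoch q q n)))"
      by (simp only: norm_mult norm_power)
    also have "\<dots> \<le> norm q ^ n * (V * V)"
      using V by (intro mult_left_mono mult_mono) auto
    finally show ?thesis .
  qed
  moreover have "summable (\<lambda>n. norm q ^ n * (V * V))"
    using q by (intro summable_mult2 summable_geometric) simp
  ultimately have "summable (\<lambda>n. norm (chain_weight q 0 n))"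
    by (auto intro: summable_comparison_test'[where N = 0 and g = "\<lambda>n. norm q ^ n * (V * V)"])
  then show ?thesis by (intro norm_summable_imp_summable_on) simp
qed

lemma norm_chain_weight_le:
  assumes "norm q < 1"
  shows "norm (chain_weight q m n) \<le> norm (chain_weight q 0 n)"
  unfolding chain_weight_def norm_divide norm_power
  using assms by (intro divide_right_mono power_decreasing) auto

text \<open>Dropping the coupling factors \<open>q^(m n)\<close> only enlarges norms, so a product
  of independent summable weights dominates the chain.\<close>

lemma chain_term_summable:
  assumes q: "norm q < 1" and k: "k \<ge> 1"
  shows "(\<lambda>n. norm (chain_term k a q n)) summable_on ({1..k} \<rightarrow>\<^sub>E UNIV)"
  using k
proof (induction k rule: nat_induct_at_least)
  case base
  obtain M where M: "M > 0" "\<And>n. norm (qpoch a q n) \<le> M" using qpoch_bounded[OF q] by metis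
  have "(\<lambda>n. norm (of_real M * chain_weight q 0 n)) summable_on UNIV"
    unfolding norm_mult by (intro summable_on_cmult_right chain_weight_summable q)
  then have "(\<lambda>n. norm (qpoch a q n * chain_weight q 0 n)) summable_on UNIV"
    by (rule Infinite_Sum.abs_summable_on_comparison_test)
      (use M in \<open>simp add: norm_mult mult_right_mono\<close>)
  then show ?case
    unfolding summable_on_reindex_bij_betw[OF bij_betw_PiE_1, symmetric] chain_term_1 .
next
  case (Suc k)
  have "(\<lambda>p. norm (chain_term k a q (fst p) * chain_weight q 0 (snd p)))
      summable_on ({1..k} \<rightarrow>\<^sub>E UNIV) \<times> UNIV"
    by (intro norm_summable_on_Times Suc.IH chain_weight_summable q)
  then have "(\<lambda>p. norm (chain_term k a q (fst p) * chain_weight q (fst p k) (snd p)))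
      summable_on ({1..k} \<rightarrow>\<^sub>E UNIV) \<times> UNIV"
    by (rule Infinite_Sum.abs_summable_on_comparison_test)
      (simp add: norm_mult mult_left_mono norm_chain_weight_le q)
  then show ?case
    unfolding summable_on_reindex_bij_betw[OF bij_betw_PiE_Suc, symmetric]
      chain_term_fun_upd[OF Suc.hyps] .
qed

text \<open>The prefactor \<open>(q)_m\<close> cancels one of the two factors in the denominator of
  \<open>chain_weight\<close> and reappears in the image under the kernel.\<close>

definition legendre_eigenfun :: "complex \<Rightarrow> nat \<Rightarrow> nat \<Rightarrow> complex" where
  "legendre_eigenfun q v m = qpoch q q m * legendre_poly q v (q ^ m)"

lemma legendre_eigenfun_bounded:
  assumes q: "norm q < 1"
  obtains M where "M > 0" "\<And>v m. norm (legendre_eigenfun q v m) \<le> M * real (Suc v)"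
proof -
  obtain U where U: "U > 0" "\<And>n. norm (qpoch q q n) \<le> U" using qpoch_bounded[OF q] by metis
  obtain M where M: "M > 0" "\<And>v x. norm x \<le> 1 \<Longrightarrow> norm (legendre_poly q v x) \<le> M * real (Suc v)"
    using legendre_poly_bounded[OF q] by metis
  have "norm (legendre_eigenfun q v m) \<le> U * (M * real (Suc v))" for v m
    unfolding legendre_eigenfun_def norm_mult
    using q U M(1) by (intro mult_mono M(2)) (auto simp: norm_power power_le_one)
  then show ?thesis using that[of "U * M"] U M by (simp add: mult.assoc)
qed

lemma summable_mult_eigenfun:
  fixes f :: "'a \<Rightarrow> complex"
  assumes q: "norm q < 1" and f: "(\<lambda>x. norm (f x)) summable_on A"
  shows "(\<lambda>x. norm (f x * legendre_eigenfun q v (h x))) summable_on A"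
proof -
  obtain M where M: "M > 0" "\<And>v m. norm (legendre_eigenfun q v m) \<le> M * real (Suc v)"
    using legendre_eigenfun_bounded[OF q] by metis
  have "(\<lambda>x. norm (f x * of_real (M * real (Suc v)))) summable_on A"
    unfolding norm_mult by (intro summable_on_cmult_left f)
  then show ?thesis
  proof (rule Infinite_Sum.abs_summable_on_comparison_test)
    fix x
    have "norm (legendre_eigenfun q v (h x)) \<le> norm (of_real (M * real (Suc v)) :: complex)"
      using M by (simp add: norm_mult abs_mult flip: of_nat_Suc)
    then show "norm (f x * legendre_eigenfun q v (h x)) \<le> norm (f x * of_real (M * real (Suc v)))"
      unfolding norm_mult by (intro mult_left_mono) auto
  qed
qed

definition chain_eigenvalue :: "complex \<Rightarrow> nat \<Rightarrow> complex" where
  "chain_eigenvalue q v = (-1) ^ v * q ^ (Suc v choose 2) / qpoch_inf q q"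

text \<open>After cancelling one \<open>(q)_n\<close> this is \<open>legendre_poly_kernel\<close>.
  For fixed \<open>v\<close> the eigenfunction is bounded, so the series converges absolutely and
  the ordered sum becomes an unordered one.\<close>

lemma eigenfun_chain_weight:
  assumes q: "norm q < 1"
  shows "((\<lambda>n. chain_weight q m n * legendre_eigenfun q v n)
    has_sum (chain_eigenvalue q v * legendre_eigenfun q v m)) UNIV"
proof -
  have "(\<lambda>n. norm (chain_weight q m n)) summable_on UNIV"
    by (rule Infinite_Sum.abs_summable_on_comparison_test[OF chain_weight_summable[OF q]])
      (rule norm_chain_weight_le[OF q])
  from summable_mult_eigenfun[OF q this, of v "\<lambda>x. x"]
  have "summable (\<lambda>n. norm (chain_weight q m n * legendre_eigenfun q v n))"
    by (rule summable_on_imp_summable)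
  moreover have "chain_weight q m n * legendre_eigenfun q v n =
     q ^ (m * n + n) / qpoch q q n * legendre_poly q v (q ^ n)" for n
    using qpoch_nonzero[OF q q, of n]
    by (simp add: chain_weight_def legendre_eigenfun_def power2_eq_square)
  ultimately show ?thesis
    using legendre_poly_kernel[OF q, of m v]
    unfolding chain_eigenvalue_def legendre_eigenfun_def
    by (intro norm_summable_imp_has_sum) simp_all
qed

text \<open>The value found in \<open>legendre_poly_moment\<close>: the sum over the first variable,
  including its factor \<open>(a)_n\<close>, against the eigenfunction.\<close>

definition end_moment :: "complex \<Rightarrow> complex \<Rightarrow> nat \<Rightarrow> complex" where
  "end_moment a q v = qpoch_inf (a * q) q / qpoch_inf q q *
      (q ^ (v choose 2) * (\<Prod>i<v. q ^ Suc v - a * q * q ^ i) / qpoch (a * q) q v)"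

text \<open>Summing the last variable first moves the eigenfunction to its neighbour at the cost of
  one eigenvalue. The \<open>k - 1\<close> couplings give the power, and the first variable leaves
  the end moment.\<close>

lemma chain_term_eigenfun:
  assumes q: "norm q < 1" and a: "norm a \<le> 1" and k: "k \<ge> 1"
  shows "((\<lambda>n. chain_term k a q n * legendre_eigenfun q v (n k))
    has_sum (chain_eigenvalue q v ^ (k - 1) * end_moment a q v)) ({1..k} \<rightarrow>\<^sub>E UNIV)"
  using k
proof (induction k rule: nat_induct_at_least)
  case base
  have eq: "qpoch a q j * chain_weight q 0 j * legendre_eigenfun q v j =
      q ^ j * qpoch a q j / qpoch q q j * legendre_poly q v (q ^ j)" for j
    using qpoch_nonzero[OF q q, of j]
    by (simp add: chain_weight_def legendre_eigenfun_def power2_eq_square)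
  have "(\<lambda>n. norm (chain_term 1 a q n * legendre_eigenfun q v (n 1))) summable_on ({1..1} \<rightarrow>\<^sub>E UNIV)"
    by (intro summable_mult_eigenfun chain_term_summable q) simp
  then have "(\<lambda>j. norm (qpoch a q j * chain_weight q 0 j * legendre_eigenfun q v j)) summable_on UNIV"
    unfolding summable_on_reindex_bij_betw[OF bij_betw_PiE_1, symmetric] chain_term_1 by simp
  then have "((\<lambda>j. qpoch a q j * chain_weight q 0 j * legendre_eigenfun q v j)
      has_sum end_moment a q v) UNIV"
    using legendre_poly_moment[OF q a, of v] unfolding eq end_moment_def
    by (intro norm_summable_imp_has_sum summable_on_imp_summable)
  then show ?case
    unfolding has_sum_reindex_bij_betw[OF bij_betw_PiE_1, symmetric] chain_term_1 by simp
next
  case (Suc k)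
  define f where "f p = chain_term k a q (fst p) * chain_weight q (fst p k) (snd p)
      * legendre_eigenfun q v (snd p)" for p :: "(nat \<Rightarrow> nat) \<times> nat"
  have "(\<lambda>n. norm (chain_term (Suc k) a q n * legendre_eigenfun q v (n (Suc k))))
      summable_on ({1..Suc k} \<rightarrow>\<^sub>E UNIV)"
    by (intro summable_mult_eigenfun chain_term_summable q) simp
  then have "(\<lambda>p. norm (f p)) summable_on ({1..k} \<rightarrow>\<^sub>E UNIV) \<times> UNIV"
    unfolding summable_on_reindex_bij_betw[OF bij_betw_PiE_Suc, symmetric]
      chain_term_fun_upd[OF Suc.hyps] f_def by simp
  then have summ: "f summable_on ({1..k} \<rightarrow>\<^sub>E UNIV) \<times> UNIV"
    by (rule abs_summable_summable)
  have "(f has_sum (chain_eigenvalue q v * (chain_eigenvalue q v ^ (k - 1) * end_moment a q v)))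
      (({1..k} \<rightarrow>\<^sub>E UNIV) \<times> UNIV)"
  proof (rule has_sum_SigmaI[OF _ _ summ])
    show "((\<lambda>y. f (n, y)) has_sum chain_eigenvalue q v * (chain_term k a q n * legendre_eigenfun q v (n k))) UNIV" for n
      using has_sum_cmult_right[OF eigenfun_chain_weight[OF q, of "n k" v], of "chain_term k a q n"]
      by (simp add: f_def mult_ac)
    show "((\<lambda>n. chain_eigenvalue q v * (chain_term k a q n * legendre_eigenfun q v (n k)))
       has_sum chain_eigenvalue q v * (chain_eigenvalue q v ^ (k - 1) * end_moment a q v)) ({1..k} \<rightarrow>\<^sub>E UNIV)"
      by (intro has_sum_cmult_right Suc.IH)
  qed
  moreover have "chain_eigenvalue q v * (chain_eigenvalue q v ^ (k - 1) * end_moment a q v)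
     = chain_eigenvalue q v ^ (Suc k - 1) * end_moment a q v"
    using Suc.hyps by (cases k) simp_all
  ultimately have "(f has_sum (chain_eigenvalue q v ^ (Suc k - 1) * end_moment a q v))
      (({1..k} \<rightarrow>\<^sub>E UNIV) \<times> UNIV)"
    by (simp only:)
  then show ?case
    unfolding has_sum_reindex_bij_betw[OF bij_betw_PiE_Suc, symmetric]
      chain_term_fun_upd[OF Suc.hyps] f_def by (simp only: fun_upd_same)
qed

text \<open>Coefficients of the constant function 1 in the eigenfunctions.\<close>

definition unit_coeff :: "complex \<Rightarrow> nat \<Rightarrow> complex" where
  "unit_coeff q v = q ^ (Suc v choose 2) * (1 - q ^ (2 * v + 1)) / qpoch_inf q q"

text \<open>This is \<open>legendre_expansion\<close> at \<open>x = q^m\<close>, normalised by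
  \<open>(q)_m (q^(m+1))_\<infinity> = (q)_\<infinity>\<close>.\<close>

lemma unit_expansion:
  assumes q: "norm q < 1"
  shows "((\<lambda>v. unit_coeff q v * legendre_eigenfun q v m) has_sum 1) UNIV"
proof -
  have "norm (q ^ m) \<le> 1" using q by (simp add: norm_power power_le_one)
  from has_sum_cmult_right[OF legendre_expansion[OF q this], of "qpoch q q m / qpoch_inf q q"]
  have "((\<lambda>v. unit_coeff q v * legendre_eigenfun q v m) has_sum
      (qpoch q q m / qpoch_inf q q * qpoch_inf (q ^ m * q) q)) UNIV"
    by (simp add: unit_coeff_def legendre_eigenfun_def mult_ac)
  moreover have "qpoch q q m * qpoch_inf (q ^ m * q) q = qpoch_inf q q"
    using qpoch_inf_split[OF q, of q m] by (simp add: mult.commute)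
  ultimately show ?thesis using qpoch_inf_nonzero[OF q q] by simp
qed

text \<open>The factor \<open>Suc v\<close> absorbs the linear growth in \<open>v\<close> of the
  bound for the eigenfunctions.\<close>

lemma unit_coeff_summable:
  assumes q: "norm q < 1"
  shows "(\<lambda>v. norm (unit_coeff q v * of_nat (Suc v))) summable_on UNIV"
proof -
  define C where "C = 2 / norm (qpoch_inf q q)"
  have bound: "norm (unit_coeff q v * of_nat (Suc v)) \<le> C * (of_nat (Suc v) * norm q ^ v)" for v
  proof -
    have "norm (1 - q ^ (2 * v + 1)) \<le> 1 + norm q ^ (2 * v + 1)"
      by (metis norm_one norm_power norm_triangle_ineq4)
    also have "\<dots> \<le> 2" using q power_le_one[of "norm q" "2 * v + 1"] by auto
    finally have 2: "norm (1 - q ^ (2 * v + 1)) \<le> 2" .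
    have 1: "norm q ^ (Suc v choose 2) \<le> norm q ^ v"
      using q by (intro power_decreasing) (auto simp: choose_two_Suc)
    have "norm (unit_coeff q v * of_nat (Suc v)) \<le> norm q ^ v * 2 / norm (qpoch_inf q q) * real (Suc v)"
      unfolding unit_coeff_def norm_mult norm_divide norm_power norm_of_nat
      by (intro mult_right_mono divide_right_mono mult_mono 1 2) auto
    then show ?thesis by (simp add: C_def mult_ac)
  qed
  have majorant: "summable (\<lambda>v. C * (of_nat (Suc v) * norm q ^ v))"
    using q by (intro summable_mult sums_summable[OF geometric_deriv_sums]) simp
  have "summable (\<lambda>v. norm (unit_coeff q v * of_nat (Suc v)))"
    by (rule summable_comparison_test'[OF majorant, where N = 0])
      (simp only: real_norm_def abs_norm_cancel bound)
  then show ?thesis by (intro norm_summable_imp_summable_on) simp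
qed

text \<open>The constant 1 at the last variable is replaced by its eigenfunction expansion. Absolute
  convergence lets the sum over tuples be taken first, where \<open>chain_term_eigenfun\<close>
  evaluates it.\<close>

lemma chain_term_has_sum:
  assumes q: "norm q < 1" and a: "norm a \<le> 1" and k: "k \<ge> 1"
  shows "(chain_term k a q has_sum
      (\<Sum>\<^sub>\<infinity>v. unit_coeff q v * (chain_eigenvalue q v ^ (k - 1) * end_moment a q v)))
      ({1..k} \<rightarrow>\<^sub>E UNIV)"
proof -
  let ?P = "{1..k} \<rightarrow>\<^sub>E (UNIV :: nat set)"
  define f where "f n v = chain_term k a q n * (unit_coeff q v * legendre_eigenfun q v (n k))" for n v
  obtain M where M: "M > 0" "\<And>v m. norm (legendre_eigenfun q v m) \<le> M * real (Suc v)"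
    using legendre_eigenfun_bounded[OF q] by metis
  have "(\<lambda>n. norm (of_real M * chain_term k a q n)) summable_on ?P"
    unfolding norm_mult by (intro summable_on_cmult_right chain_term_summable q k)
  from norm_summable_on_Times[OF this unit_coeff_summable[OF q]]
  have "(\<lambda>p. norm (f (fst p) (snd p))) summable_on ?P \<times> UNIV"
  proof (rule Infinite_Sum.abs_summable_on_comparison_test)
    fix p :: "(nat \<Rightarrow> nat) \<times> nat"
    obtain n v where p: "p = (n, v)" by (cases p)
    have "norm (f n v) = norm (chain_term k a q n) * norm (unit_coeff q v) * norm (legendre_eigenfun q v (n k))"
      by (simp add: f_def norm_mult)
    also have "\<dots> \<le> norm (chain_term k a q n) * norm (unit_coeff q v) * (M * real (Suc v))"
      by (intro mult_left_mono M) auto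
    also have "\<dots> = norm (of_real M * chain_term k a q n * (unit_coeff q v * of_nat (Suc v)))"
      using M(1) by (simp only: norm_mult norm_of_nat norm_of_real) simp
    finally show "norm (f (fst p) (snd p))
        \<le> norm (of_real M * chain_term k a q (fst p) * (unit_coeff q (snd p) * of_nat (Suc (snd p))))"
      by (simp only: p fst_conv snd_conv)
  qed
  then have summ: "(\<lambda>(n, v). f n v) summable_on ?P \<times> UNIV"
    unfolding case_prod_unfold by (rule abs_summable_summable)
  have rows: "(\<Sum>\<^sub>\<infinity>v. f n v) = chain_term k a q n" for n
    using infsumI[OF has_sum_cmult_right[OF unit_expansion[OF q, of "n k"], of "chain_term k a q n"]]
    by (simp add: f_def)
  have columns: "(\<Sum>\<^sub>\<infinity>n\<in>?P. f n v) = unit_coeff q v * (chain_eigenvalue q v ^ (k - 1) * end_moment a q v)" for v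
    using infsumI[OF has_sum_cmult_right[OF chain_term_eigenfun[OF q a k, of v], of "unit_coeff q v"]]
    by (simp add: f_def mult_ac)
  have "infsum (chain_term k a q) ?P = (\<Sum>\<^sub>\<infinity>v. unit_coeff q v * (chain_eigenvalue q v ^ (k - 1) * end_moment a q v))"
    using infsum_swap_banach[OF summ] unfolding rows columns .
  moreover have "chain_term k a q summable_on ?P"
    by (rule abs_summable_summable[OF chain_term_summable[OF q k]])
  ultimately show ?thesis by (metis has_sum_infsum)
qed

section \<open>Theta series folded onto the natural numbers by pairing \<open>v\<close> with
  \<open>- v - 1\<close>\<close>

lemma signed_bisum_nat:
  fixes f :: "int \<Rightarrow> complex"
  assumes pos: "summable (\<lambda>v. norm (f (int v)))" and neg: "summable (\<lambda>v. norm (f (- int (Suc v))))"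
  shows "signed_bisum c f = (\<Sum>\<^sub>\<infinity>v. f (int v) + c * f (- int (Suc v)))"
proof -
  have "bij_betw int UNIV {0..}"
    by (rule bij_betw_byWitness[where f' = nat]) auto
  then have 1: "(\<Sum>\<^sub>\<infinity>n\<in>{0..}. f n) = (\<Sum>\<^sub>\<infinity>v. f (int v))"
    by (rule infsum_reindex_bij_betw[symmetric])
  have "bij_betw (\<lambda>v. - int (Suc v)) UNIV {..<0}"
    by (rule bij_betw_byWitness[where f' = "\<lambda>n. nat (- n - 1)"]) auto
  then have 2: "(\<Sum>\<^sub>\<infinity>n\<in>{..<0}. f n) = (\<Sum>\<^sub>\<infinity>v. f (- int (Suc v)))"
    by (rule infsum_reindex_bij_betw[symmetric])
  show ?thesis
    unfolding signed_bisum_def 1 2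
    using norm_summable_imp_summable_on[OF pos] norm_summable_imp_summable_on[OF neg]
    by (simp add: infsum_add summable_on_cmult_right infsum_cmult_right')
qed

lemma minus_one_powi_int: "(-1 :: complex) powi (int n) = (-1) ^ n" "(-1 :: complex) powi (- int n) = (-1) ^ n"
  by (simp_all add: power_int_minus flip: power_inverse)

text \<open>The sign at \<open>- v - 1\<close>, multiplied by \<open>(-1)^k\<close>, is opposite to
  the sign at \<open>v\<close> because \<open>k + (k + 1)\<close> is odd. Each pair therefore gives
  a factor \<open>1 - x^D\<close>, where \<open>D\<close> is the gap between the two
  exponents.\<close>

lemma signed_theta:
  fixes x :: complex and e :: "int \<Rightarrow> int" and E D :: "nat \<Rightarrow> nat"
  assumes x: "norm x < 1"
    and pos: "\<And>v. e (int v) = int (E v)" and neg: "\<And>v. e (- int (Suc v)) = int (E v + D v)"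
    and growth: "\<And>v. v \<le> E v"
  shows "signed_bisum ((-1) ^ k) (\<lambda>n. (-1) powi ((int k + 1) * n) * x powi e n)
     = (\<Sum>\<^sub>\<infinity>v. (-1) ^ ((k + 1) * v) * x ^ E v * (1 - x ^ D v))"
proof -
  define f where "f n = (-1) powi ((int k + 1) * n) * x powi e n" for n
  have f_pos: "f (int v) = (-1) ^ ((k + 1) * v) * x ^ E v" for v
  proof -
    have "(int k + 1) * int v = int ((k + 1) * v)" by (simp add: algebra_simps)
    then have "(-1 :: complex) powi ((int k + 1) * int v) = (-1) ^ ((k + 1) * v)"
      by (simp only: minus_one_powi_int)
    then show ?thesis by (simp only: f_def pos power_int_of_nat)
  qed
  have f_neg: "f (- int (Suc v)) = (-1) ^ ((k + 1) * Suc v) * x ^ (E v + D v)" for v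
  proof -
    have "(int k + 1) * - int (Suc v) = - int ((k + 1) * Suc v)" by (simp add: algebra_simps)
    then have "(-1 :: complex) powi ((int k + 1) * - int (Suc v)) = (-1) ^ ((k + 1) * Suc v)"
      by (simp only: minus_one_powi_int)
    then show ?thesis by (simp only: f_def neg power_int_of_nat)
  qed
  have bounds: "norm (f (int v)) \<le> norm x ^ v" "norm (f (- int (Suc v))) \<le> norm x ^ v" for v
    unfolding f_pos f_neg norm_mult norm_power
    using x growth[of v] by (auto intro!: power_decreasing)
  have majorised: "summable (\<lambda>v. norm (g v))" if "\<And>v. norm (g v) \<le> norm x ^ v" for g :: "nat \<Rightarrow> complex"
    by (rule summable_comparison_test'[where g = "\<lambda>v. norm x ^ v" and N = 0])
      (use that x in \<open>simp_all add: summable_geometric\<close>)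
  have summ: "summable (\<lambda>v. norm (f (int v)))" "summable (\<lambda>v. norm (f (- int (Suc v))))"
    by (rule majorised, rule bounds)+
  have "f (int v) + (-1) ^ k * f (- int (Suc v)) = (-1) ^ ((k + 1) * v) * x ^ E v * (1 - x ^ D v)" for v
  proof -
    have "(-1) ^ k * (-1) ^ ((k + 1) * Suc v) = - ((-1 :: complex) ^ ((k + 1) * v))"
      by (simp add: power_add flip: power_mult_distrib)
    then have "(-1) ^ k * f (- int (Suc v)) = - ((-1) ^ ((k + 1) * v)) * x ^ (E v + D v)"
      unfolding f_neg by (simp only: mult.assoc[symmetric])
    then show ?thesis unfolding f_pos by (simp add: power_add algebra_simps)
  qed
  then show ?thesis
    using signed_bisum_nat[OF summ, of "(-1) ^ k"] by (simp only: f_def)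
qed

text \<open>Each factor is \<open>q^(i+1) (1 + q q^(v-1-i))\<close>. In reverse order the second
  parts form \<open>(-q)_v\<close>, which cancels the denominator.\<close>

lemma end_moment_minus_one:
  assumes q: "norm q < 1"
  shows "end_moment (-1) q v = qpoch_inf (-q) q / qpoch_inf q q * q ^ (v * v)"
proof -
  have "(\<Prod>i<v. q ^ Suc v - (-1) * q * q ^ i) = (\<Prod>i<v. q ^ Suc i * (1 - (-q) * q ^ (v - Suc i)))"
  proof (rule prod.cong)
    fix i assume "i \<in> {..<v}"
    then obtain d where "v = Suc i + d" using less_iff_Suc_add by auto
    then show "q ^ Suc v - (-1) * q * q ^ i = q ^ Suc i * (1 - (-q) * q ^ (v - Suc i))"
      by (simp add: power_add algebra_simps)
  qed simp
  also have "\<dots> = (\<Prod>i<v. q ^ Suc i) * qpoch (-q) q v"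
    unfolding prod.distrib qpoch_def using prod.nat_diff_reindex[of "\<lambda>i. 1 - (-q) * q ^ i" v] by simp
  also have "(\<Prod>i<v. q ^ Suc i) = q ^ (Suc v choose 2)"
    by (induction v) (simp_all add: choose_two_Suc power_add mult_ac numeral_2_eq_2)
  finally have prod: "(\<Prod>i<v. q ^ Suc v - (-1) * q * q ^ i) = q ^ (Suc v choose 2) * qpoch (-q) q v" .
  have "q ^ (v choose 2) * q ^ (Suc v choose 2) = q ^ (v * v)"
    using choose_two_double[of v] by (simp add: choose_two_Suc add_ac mult_2 flip: power_add)
  moreover have "qpoch (-q) q v \<noteq> 0" using q by (intro qpoch_nonzero) auto
  ultimately show ?thesis
    unfolding end_moment_def prod by (simp add: mult.assoc[symmetric])
qed

text \<open>Here the reversed product is \<open>(-r)_v\<close> while the denominator is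
  \<open>(-r q)_v\<close>. Their quotient is \<open>(1 + r) / (1 + r^(2v+1))\<close>: the numerator
  completes the infinite product, and the denominator is the extra factor on the left.\<close>

lemma end_moment_sqrt:
  assumes q: "norm q < 1" and r: "r\<^sup>2 = q"
  shows "end_moment (-r) q v * (1 + r ^ (2 * v + 1)) = qpoch_inf (-r) q / qpoch_inf q q * r ^ (2 * v * v + v)"
proof -
  have "norm r ^ 2 < 1" using q r by (metis norm_power)
  then have r1: "norm r < 1" by (simp add: power_less_one_iff abs_square_less_1)
  have rq: "norm (- r * q) < 1" using r1 r q mult_strict_mono[of "norm r" 1 "norm q" 1] by (simp add: norm_mult)
  have "(\<Prod>i<v. q ^ Suc v - (-r) * q * q ^ i) = (\<Prod>i<v. r ^ (2 * i + 3) * (1 - (-r) * q ^ (v - Suc i)))"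
  proof (rule prod.cong)
    fix i assume "i \<in> {..<v}"
    then obtain d where "v = Suc i + d" using less_iff_Suc_add by auto
    then show "q ^ Suc v - (-r) * q * q ^ i = r ^ (2 * i + 3) * (1 - (-r) * q ^ (v - Suc i))"
      by (simp add: r[symmetric] power_add algebra_simps eval_nat_numeral power_mult_distrib)
  qed simp
  also have "\<dots> = (\<Prod>i<v. r ^ (2 * i + 3)) * qpoch (-r) q v"
    unfolding prod.distrib qpoch_def using prod.nat_diff_reindex[of "\<lambda>i. 1 - (-r) * q ^ i" v] by simp
  also have "(\<Prod>i<v. r ^ (2 * i + 3)) = r ^ (v * v + 2 * v)"
    by (induction v) (simp_all add: power_add algebra_simps eval_nat_numeral)
  finally have prod: "(\<Prod>i<v. q ^ Suc v - (-r) * q * q ^ i) = r ^ (v * v + 2 * v) * qpoch (-r) q v" .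
  have "2 * (v choose 2) + (v * v + 2 * v) = 2 * v * v + v"
    using choose_two_double[of v] by simp
  then have e: "q ^ (v choose 2) * r ^ (v * v + 2 * v) = r ^ (2 * v * v + v)"
    by (simp only: r[symmetric] power_mult[symmetric] power_add[symmetric])
  have shift: "qpoch (-r) q v * (1 + r ^ (2 * v + 1)) = (1 + r) * qpoch (- r * q) q v"
    using qpoch_Suc[of "-r" q v] qpoch_rec[of "-r" q v] by (simp add: r[symmetric] power_mult)
  have inf: "qpoch_inf (-r) q = (1 + r) * qpoch_inf (- r * q) q"
    using qpoch_inf_split[OF q, of "-r" 1] by (simp add: qpoch_def)
  have "end_moment (-r) q v * (1 + r ^ (2 * v + 1)) = qpoch_inf (- r * q) q / qpoch_inf q q *
      (q ^ (v choose 2) * r ^ (v * v + 2 * v)) * (qpoch (-r) q v * (1 + r ^ (2 * v + 1))) / qpoch (- r * q) q v"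
    unfolding end_moment_def prod by simp
  also have "\<dots> = qpoch_inf (-r) q / qpoch_inf q q * r ^ (2 * v * v + v)"
    unfolding shift e inf using qpoch_nonzero[OF q rq, of v] by simp
  finally show ?thesis .
qed

text \<open>Collects powers: \<open>k - 1\<close> eigenvalues and one \<open>unit_coeff\<close> give
  \<open>k\<close> triangular exponents, the end moment supplies one more
  \<open>1 / (q)_\<infinity>\<close>, and the signs agree since \<open>k - 1\<close> and
  \<open>k + 1\<close> have the same parity.\<close>

lemma chain_spectral_term:
  assumes "k \<ge> 1"
  shows "unit_coeff q v * (chain_eigenvalue q v ^ (k - 1) * (C / qpoch_inf q q * X))
    = C / qpoch_inf q q ^ (k + 1) * ((-1) ^ ((k + 1) * v) * q ^ (k * (Suc v choose 2)) * X * (1 - q ^ (2 * v + 1)))"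
proof -
  obtain l where k: "k = Suc l" using assms by (cases k) auto
  have "((-1) ^ v * q ^ (Suc v choose 2)) ^ l = (-1) ^ ((k + 1) * v) * q ^ (l * (Suc v choose 2))"
    by (simp add: k power_mult_distrib power_add mult.commute flip: power_mult)
  then show ?thesis
    by (simp add: k unit_coeff_def chain_eigenvalue_def power_divide power_add mult_ac)
qed

theorem theorem4p3:
  fixes k :: nat and q :: complex
  assumes "k \<ge> 2" and "norm q < 1"
  shows
    "(chain_term k (-1) q has_sum
        qpoch_inf (-q) q / qpoch_inf q q ^ (k + 1) *
        signed_bisum ((-1) ^ k)
          (\<lambda>n. (-1) powi ((int k + 1) * n) * q powi (((int k + 2) * n\<^sup>2 + int k * n) div 2)))
      ({1..k} \<rightarrow>\<^sub>E UNIV)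
    \<and>
    (\<forall>r. r\<^sup>2 = q \<longrightarrow>
      (chain_term k (-r) q has_sum
        qpoch_inf (-r) q / qpoch_inf q q ^ (k + 1) *
        signed_bisum ((-1) ^ k)
          (\<lambda>n. (-1) powi ((int k + 1) * n) * r powi ((int k + 2) * n\<^sup>2 + (int k + 1) * n)))
      ({1..k} \<rightarrow>\<^sub>E UNIV))"
proof (intro conjI allI impI)
  note q = assms(2)
  have k: "k \<ge> 1" using assms(1) by simp
  \<comment> \<open>The exponent at \<open>n = v\<close>: \<open>k\<close> triangular numbers from
    the spectral term and \<open>v^2\<close> from the end moment. The doubled form shows that the
    division by 2 is exact.\<close>
  define E where "E v = k * (Suc v choose 2) + v * v" for v
  have E: "2 * int (E v) = int k * (int v * int v + int v) + 2 * (int v * int v)" for v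
  proof -
    have "2 * (Suc v choose 2) = v * v + v"
      using choose_two_double[of v] by (simp add: choose_two_Suc)
    then have "2 * E v = k * (v * v + v) + 2 * (v * v)"
      by (simp only: E_def distrib_left mult.left_commute[of 2 k])
    then have "int (2 * E v) = int (k * (v * v + v) + 2 * (v * v))" by simp
    then show ?thesis by simp
  qed
  have E_pos: "((int k + 2) * (int v)\<^sup>2 + int k * int v) div 2 = int (E v)" for v
    using E[of v] by (simp add: power2_eq_square algebra_simps)
  \<comment> \<open>At \<open>- v - 1\<close> the exponent is larger by \<open>2 v + 1\<close>,
    which matches the factor \<open>1 - q^(2v+1)\<close> of \<open>unit_coeff\<close>.\<close>
  have E_neg: "((int k + 2) * (- int (Suc v))\<^sup>2 + int k * - int (Suc v)) div 2 = int (E v + (2 * v + 1))" for v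
  proof -
    have "(int k + 2) * (- int (Suc v))\<^sup>2 + int k * - int (Suc v) = 2 * int (E v + (2 * v + 1))"
      using E[of v] by (simp add: power2_eq_square algebra_simps)
    then show ?thesis by simp
  qed
  have E_growth: "v \<le> E v" for v
    by (cases v) (simp_all add: E_def)
  have "unit_coeff q v * (chain_eigenvalue q v ^ (k - 1) * end_moment (-1) q v)
      = qpoch_inf (-q) q / qpoch_inf q q ^ (k + 1) * ((-1) ^ ((k + 1) * v) * q ^ E v * (1 - q ^ (2 * v + 1)))" for v
    unfolding end_moment_minus_one[OF q] chain_spectral_term[OF k] by (simp add: E_def power_add mult_ac)
  then show "(chain_term k (-1) q has_sum
        qpoch_inf (-q) q / qpoch_inf q q ^ (k + 1) *
        signed_bisum ((-1) ^ k)
          (\<lambda>n. (-1) powi ((int k + 1) * n) * q powi (((int k + 2) * n\<^sup>2 + int k * n) div 2)))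
      ({1..k} \<rightarrow>\<^sub>E UNIV)"
    using chain_term_has_sum[OF q _ k, of "-1"]
    unfolding signed_theta[OF q E_pos E_neg E_growth]
    by (simp only: infsum_cmult_right') simp
next
  fix r :: complex
  assume r: "r\<^sup>2 = q"
  note q = assms(2)
  have k: "k \<ge> 1" using assms(1) by simp
  have "norm r ^ 2 < 1" using q r by (metis norm_power)
  then have r1: "norm r < 1" by (simp add: abs_square_less_1)
  \<comment> \<open>Exponents are counted in powers of \<open>r\<close>, hence doubled, and no
    halves occur.\<close>
  define E where "E v = (k + 2) * (v * v) + (k + 1) * v" for v
  have E_pos: "(int k + 2) * (int v)\<^sup>2 + (int k + 1) * int v = int (E v)" for v
    by (simp add: E_def power2_eq_square algebra_simps)
  have E_neg: "(int k + 2) * (- int (Suc v))\<^sup>2 + (int k + 1) * - int (Suc v) = int (E v + (2 * v + 1))" for v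
    by (simp add: E_def power2_eq_square algebra_simps)
  have E_growth: "v \<le> E v" for v
    by (simp add: E_def)
  have "unit_coeff q v * (chain_eigenvalue q v ^ (k - 1) * end_moment (-r) q v)
      = qpoch_inf (-r) q / qpoch_inf q q ^ (k + 1) * ((-1) ^ ((k + 1) * v) * r ^ E v * (1 - r ^ (2 * v + 1)))" for v
  proof -
    have "r ^ (2 * v + 1) \<noteq> -1"
    proof
      assume "r ^ (2 * v + 1) = -1"
      then have "norm r ^ (2 * v + 1) = 1" by (metis norm_minus_cancel norm_one norm_power)
      then show False using r1 power_less_one_iff[of "norm r" "2 * v + 1"] by simp
    qed
    then have nz: "1 + r ^ (2 * v + 1) \<noteq> 0" by (metis add.commute add_eq_0_iff)
    have moment: "end_moment (-r) q v = qpoch_inf (-r) q / qpoch_inf q q * (r ^ (2 * v * v + v) / (1 + r ^ (2 * v + 1)))"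
      using end_moment_sqrt[OF q r, of v] nz by (simp only: times_divide_eq_right nonzero_eq_divide_eq[OF nz])
    \<comment> \<open>The factor \<open>1 + r^(2v+1)\<close> cancels the denominator of the end
      moment and leaves \<open>1 - r^(2v+1)\<close>, the gap of the second theta series.\<close>
    have "1 - q ^ (2 * v + 1) = (1 - r ^ (2 * v + 1)) * (1 + r ^ (2 * v + 1))"
      by (simp add: r[symmetric] power2_eq_square power_mult_distrib algebra_simps)
    moreover have "2 * (Suc v choose 2) = v * v + v"
      using choose_two_double[of v] by (simp add: choose_two_Suc)
    then have "2 * (k * (Suc v choose 2)) + (2 * v * v + v) = E v"
      by (simp only: E_def mult.left_commute[of 2 k]) (simp add: algebra_simps)
    then have "q ^ (k * (Suc v choose 2)) * r ^ (2 * v * v + v) = r ^ E v"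
      by (simp only: r[symmetric] power_mult[symmetric] power_add[symmetric])
    moreover have "s * x * (y / d) * (z * d) = s * (x * y) * z" if "d \<noteq> 0" for s x y z d :: complex
      using that by simp
    ultimately show ?thesis
      unfolding moment chain_spectral_term[OF k] using nz by simp
  qed
  then show "(chain_term k (-r) q has_sum
        qpoch_inf (-r) q / qpoch_inf q q ^ (k + 1) *
        signed_bisum ((-1) ^ k)
          (\<lambda>n. (-1) powi ((int k + 1) * n) * r powi ((int k + 2) * n\<^sup>2 + (int k + 1) * n)))
      ({1..k} \<rightarrow>\<^sub>E UNIV)"
    using chain_term_has_sum[OF q _ k, of "-r"] r1
    unfolding signed_theta[OF r1 E_pos E_neg E_growth]
    by (simp only: infsum_cmult_right') simp
qed

end
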